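(* Let $n\ge 1$ be an integer, let $p>(n-1)/2$ be real and let $\sigma$ be a real symmetric positive definite matrix of order $n$. Let $U$ be a random matrix with Wishart distribution $\gamma_{p,\sigma}$ and let $X$ be a random vector in $\mathbb{R}^n$ such that, conditionally on $U$, $X\sim N(0,U^{-1})$. Then the density $f_{p,\sigma}$ of $X$, namely $$f_{p,\sigma}(x)=\frac{1}{(2\pi)^{n/2}}\int_{E_+}e^{-x^t u x/2}(\det u)^{1/2}\,\gamma_{p,\sigma}(du),$$ is given for all $x\in\mathbb{R}^n$ by $$f_{p,\sigma}(x)=\frac{1}{(2\pi)^{n/2}}\,\frac{\Gamma(p+\frac12)}{\Gamma(p-\frac{n-1}{2})}\,\frac{(\det\sigma)^{1/2}}{(1+\frac12 x^t\sigma x)^{p+\frac12}}.$$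
   Context: $E$ is the space of real symmetric matrices of order $n$ with scalar product $\langle u,v\rangle=\operatorname{tr}(uv)$ and the associated Lebesgue measure $du$ (unit cubes have mass one). $E_+\subset E$ is the open cone of positive definite matrices. For $p>(n-1)/2$ and $\sigma\in E_+$, the Wishart distribution $\gamma_{p,\sigma}$ is the probability measure on $E_+$ characterized by $$\int_{E_+}e^{-\operatorname{tr}(su)}\gamma_{p,\sigma}(du)=\frac{1}{\det(I_n+\sigma s)^p}\quad\text{for all } s\in E_+;$$ equivalently, it has density proportional to $e^{-\operatorname{tr}(\sigma^{-1}u)}(\det u)^{p-\frac{n+1}{2}}\mathbf 1_{E_+}(u)$ with respect to $du$. *)

theory Defs
  imports "HOL-Probability.Probability"
begin

definition posdef_cone :: "(real ^ 'n ^ 'n) set" where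
  "posdef_cone = {u. transpose u = u \<and> (\<forall>x. x \<noteq> 0 \<longrightarrow> 0 < x \<bullet> (u *v x))}"

abbreviation posdef_borel :: "(real ^ 'n ^ 'n) measure" where
  "posdef_borel \<equiv> restrict_space borel posdef_cone"

definition is_wishart :: "real \<Rightarrow> real ^ 'n ^ 'n \<Rightarrow> (real ^ 'n ^ 'n) measure \<Rightarrow> bool" where
  "is_wishart p \<sigma> M \<longleftrightarrow>
     prob_space M \<and> sets M = sets posdef_borel \<and>
     (\<forall>s \<in> posdef_cone. (\<integral>u. exp (- trace (s ** u)) \<partial>M) = 1 / det (mat 1 + \<sigma> ** s) powr p)"

text \<open>The description is proper when \<open>\<sigma>\<close> is positive definite and \<open>p > (n - 1) / 2\<close>:
  existence is classical, uniqueness is injectivity of the Laplace transform.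
  Outside that range of parameters the value need not be meaningful.\<close>

definition wishart :: "real \<Rightarrow> real ^ 'n ^ 'n \<Rightarrow> (real ^ 'n ^ 'n) measure" where
  "wishart p \<sigma> = (THE M. is_wishart p \<sigma> M)"

text \<open>The normal law with mean \<open>m\<close> and covariance matrix \<open>S\<close>, for positive definite \<open>S\<close>.\<close>

definition mv_normal :: "real ^ 'n \<Rightarrow> real ^ 'n ^ 'n \<Rightarrow> (real ^ 'n) measure" where
  "mv_normal m S = density lborel (\<lambda>x. ennreal
     (exp (- ((x - m) \<bullet> (matrix_inv S *v (x - m))) / 2)
       / ((2 * pi) powr (real CARD('n) / 2) * sqrt (det S))))"

text \<open>Conditionally on \<open>U\<close> (with values in \<open>M\<close>), the random variable \<open>X\<close> (with values in \<open>N\<close>)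
  has law \<open>K U\<close>: almost surely, \<open>P (X \<in> B | U) = K U B\<close> for each measurable \<open>B\<close>.\<close>

definition has_cond_law ::
  "'a measure \<Rightarrow> 'c measure \<Rightarrow> ('a \<Rightarrow> 'c) \<Rightarrow> 'b measure \<Rightarrow> ('a \<Rightarrow> 'b) \<Rightarrow> ('b \<Rightarrow> 'c measure) \<Rightarrow> bool" where
  "has_cond_law P N X M U K \<longleftrightarrow>
     (\<forall>B \<in> sets N. AE \<omega> in P.
        real_cond_exp P (vimage_algebra (space P) U M) (indicator (X -` B \<inter> space P)) \<omega>
          = measure (K (U \<omega>)) B)"

definition mixture_density :: "real \<Rightarrow> real ^ 'n ^ 'n \<Rightarrow> real ^ 'n \<Rightarrow> real" where
  "mixture_density p \<sigma> x =
     1 / (2 * pi) powr (real CARD('n) / 2)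
       * (\<integral>u. exp (- (x \<bullet> (u *v x)) / 2) * sqrt (det u) \<partial>wishart p \<sigma>)"

end

theory Submission
  imports Defs
begin

text \<open>
  The Wishart law is realised as the law of \<open>u = R\<^sup>T R\<close>, where the square matrix \<open>R\<close> has a density
  proportional to \<open>exp (- tr (\<sigma>\<^sup>-\<^sup>1 R\<^sup>T R)) |det R|\<^bsup>2p - n\<^esup>\<close> with respect to Lebesgue measure on all
  matrices. The substitution \<open>R \<mapsto> R A\<^sup>T\<close> with \<open>A\<^sup>T s A = 1\<close> shows that
  \<open>\<integral> exp (- tr (s R\<^sup>T R)) |det R|\<^sup>a dR = (det s)\<^bsup>- (a + n) / 2\<^esup> C\<^sub>a\<close>, which gives the Laplace transform.
  Writing \<open>|det R|\<^sup>a\<close> as \<open>|det R|\<^bsup>a + 1\<^esup>\<close> times a Gaussian integral in \<open>x\<close> and exchanging the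
  integrals turns \<open>C\<^sub>a / C\<^bsub>a + 1\<^esub>\<close> into an integral of a power of \<open>1 + |x|\<^sup>2\<close>, a quotient of two Gamma
  values; it also yields \<open>C\<^sub>a < \<infinity>\<close> for all \<open>a > - 1\<close>. The mixture integral is the case of exponent
  \<open>2p - n + 1\<close> and \<open>s = \<sigma>\<^sup>-\<^sup>1 + x x\<^sup>T / 2\<close>.

  Uniqueness of the Wishart law: exponentials \<open>exp (- tr (s u))\<close> are closed under products and
  finitely many of them embed the cone into a compact set, so Stone--Weierstrass applies.
\<close>

section \<open>Linear change of variables\<close>

lemma borel_measurable_vec_lambda [measurable (raw)]:
  fixes f :: "'a \<Rightarrow> 'n::finite \<Rightarrow> 'b::euclidean_space"
  assumes "\<And>i. (\<lambda>x. f x i) \<in> borel_measurable M"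
  shows "(\<lambda>x. \<chi> i. f x i) \<in> borel_measurable M"
proof (subst borel_measurable_euclidean_space, intro ballI)
  fix b :: "'b ^ 'n" assume "b \<in> Basis"
  then obtain i c where b: "b = axis i c" "c \<in> Basis" by (auto simp: Basis_vec_def)
  have "(\<lambda>x. f x i \<bullet> c) \<in> borel_measurable M" using assms by measurable
  then show "(\<lambda>x. (\<chi> i. f x i) \<bullet> b) \<in> borel_measurable M" by (simp add: b inner_axis)
qed

lemma borel_measurable_vec_nth_comp [measurable (raw)]:
  fixes f :: "'a \<Rightarrow> 'b::euclidean_space ^ 'n"
  assumes "f \<in> borel_measurable M"
  shows "(\<lambda>x. f x $ i) \<in> borel_measurable M"
  using assms by (rule borel_measurable_continuous_on[OF linear_continuous_on[OF bounded_linear_vec_nth]])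

lemma borel_measurable_det [measurable (raw)]:
  fixes f :: "'a \<Rightarrow> real ^ 'n ^ 'n"
  assumes [measurable]: "f \<in> borel_measurable M"
  shows "(\<lambda>x. det (f x)) \<in> borel_measurable M"
  unfolding det_def by measurable

lemma borel_measurable_matrix_vector_mult [measurable (raw)]:
  fixes f :: "'a \<Rightarrow> real ^ 'n ^ 'm" and g :: "'a \<Rightarrow> real ^ 'n"
  assumes [measurable]: "f \<in> borel_measurable M" "g \<in> borel_measurable M"
  shows "(\<lambda>x. f x *v g x) \<in> borel_measurable M"
  unfolding matrix_vector_mult_def by measurable

lemma borel_measurable_matrix_matrix_mult [measurable (raw)]:
  fixes f :: "'a \<Rightarrow> real ^ 'n ^ 'm" and g :: "'a \<Rightarrow> real ^ 'k ^ 'n"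
  assumes [measurable]: "f \<in> borel_measurable M" "g \<in> borel_measurable M"
  shows "(\<lambda>x. f x ** g x) \<in> borel_measurable M"
  unfolding matrix_matrix_mult_def by measurable

lemma nn_integral_lborel_translate:
  fixes f :: "'a::euclidean_space \<Rightarrow> ennreal"
  assumes [measurable]: "f \<in> borel_measurable borel"
  shows "(\<integral>\<^sup>+x. f (c + x) \<partial>lborel) = (\<integral>\<^sup>+x. f x \<partial>lborel)"
  by (subst (2) lborel_distr_plus[symmetric, of c], subst nn_integral_distr) auto

text \<open>Disintegration along the lines parallel to \<open>axis m 1\<close>, each averaged over a unit
  segment; this reduces the invariance under shears to that under translations of the line.\<close>

lemma nn_integral_lborel_fibre:
  fixes g :: "real ^ 'n \<Rightarrow> ennreal"
  assumes [measurable]: "g \<in> borel_measurable borel"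
  shows "(\<integral>\<^sup>+x. g x \<partial>lborel) =
    (\<integral>\<^sup>+x. indicator {0..1} (- x $ m) * (\<integral>\<^sup>+s. g (s *\<^sub>R axis m 1 + x) \<partial>lborel) \<partial>lborel)"
    (is "_ = ?r")
proof -
  let ?\<phi> = "indicator {0..1} :: real \<Rightarrow> ennreal"
  have "?r = (\<integral>\<^sup>+x. \<integral>\<^sup>+s. ?\<phi> (- x $ m) * g (s *\<^sub>R axis m 1 + x) \<partial>lborel \<partial>lborel)"
    by (intro nn_integral_cong) (simp add: nn_integral_cmult)
  also have "\<dots> = (\<integral>\<^sup>+s. \<integral>\<^sup>+x. ?\<phi> (- x $ m) * g (s *\<^sub>R axis m 1 + x) \<partial>lborel \<partial>lborel)"
    by (rule lborel_pair.Fubini') measurable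
  \<comment> \<open>Translating \<open>x\<close> by \<open>s\<close> along the axis removes
    \<open>s\<close> from the argument of \<open>g\<close>. The sign in \<open>- x $ m\<close> makes
    the remaining window a translate in \<open>s\<close>, not a reflection, and its integral over
    \<open>s\<close> is 1.\<close>
  also have "\<dots> = (\<integral>\<^sup>+s. \<integral>\<^sup>+x. ?\<phi> (s + (- x $ m)) * g x \<partial>lborel \<partial>lborel)"
  proof (rule nn_integral_cong)
    fix s :: real
    show "(\<integral>\<^sup>+x. ?\<phi> (- x $ m) * g (s *\<^sub>R axis m 1 + x) \<partial>lborel) = (\<integral>\<^sup>+x. ?\<phi> (s + (- x $ m)) * g x \<partial>lborel)"
      by (subst (2) nn_integral_lborel_translate[symmetric, where c = "s *\<^sub>R axis m 1"])
         (auto simp: axis_def)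
  qed
  also have "\<dots> = (\<integral>\<^sup>+x. \<integral>\<^sup>+s. ?\<phi> (s + (- x $ m)) * g x \<partial>lborel \<partial>lborel)"
    by (rule lborel_pair.Fubini') measurable
  also have "\<dots> = (\<integral>\<^sup>+x. g x \<partial>lborel)"
  proof (rule nn_integral_cong)
    fix x :: "real ^ 'n"
    have "(\<integral>\<^sup>+s. ?\<phi> (s + (- x $ m)) \<partial>lborel) = (\<integral>\<^sup>+s. ?\<phi> s \<partial>lborel)"
      using nn_integral_lborel_translate[of ?\<phi> "- x $ m"] by (simp add: add.commute)
    then show "(\<integral>\<^sup>+s. ?\<phi> (s + (- x $ m)) * g x \<partial>lborel) = g x"
      by (simp add: nn_integral_multc)
  qed
  finally show ?thesis by simp
qed

lemma prod_Basis_cart: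
  fixes f :: "real ^ 'n \<Rightarrow> 'b::comm_monoid_mult"
  shows "(\<Prod>b\<in>Basis. f b) = (\<Prod>i\<in>UNIV. f (axis i 1))"
proof -
  have "Basis = (\<lambda>i::'n. axis i (1::real)) ` UNIV" by (auto simp: Basis_vec_def)
  moreover have "inj (\<lambda>i::'n. axis i (1::real))" by (auto simp: inj_on_def axis_eq_axis)
  ultimately show ?thesis using prod.reindex[of "\<lambda>i::'n. axis i (1::real)" UNIV f] by (simp only: o_def)
qed

lemma sum_Basis_cart:
  fixes f :: "real ^ 'n \<Rightarrow> 'b::comm_monoid_add"
  shows "(\<Sum>b\<in>Basis. f b) = (\<Sum>i\<in>UNIV. f (axis i 1))"
proof -
  have "Basis = (\<lambda>i::'n. axis i (1::real)) ` UNIV" by (auto simp: Basis_vec_def)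
  moreover have "inj (\<lambda>i::'n. axis i (1::real))" by (auto simp: inj_on_def axis_eq_axis)
  ultimately show ?thesis using sum.reindex[of "\<lambda>i::'n. axis i (1::real)" UNIV f] by (simp only: o_def)
qed

text \<open>The library's Jacobian of a linear map needs an order on the index type.\<close>

lemma nn_integral_lborel_matrix:
  fixes A :: "real ^ 'n ^ 'n" and g :: "real ^ 'n \<Rightarrow> ennreal"
  assumes "det A \<noteq> 0" "g \<in> borel_measurable borel"
  shows "ennreal \<bar>det A\<bar> * (\<integral>\<^sup>+x. g (A *v x) \<partial>lborel) = (\<integral>\<^sup>+x. g x \<partial>lborel)"
proof -
  \<comment> \<open>The claim quantifies over \<open>g\<close> because the product case applies the
    hypothesis for \<open>B\<close> to \<open>g\<close> composed with \<open>A\<close>. The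
    nonvanishing determinant is part of the claim, so that a zero row makes it vacuous.\<close>
  let ?P = "\<lambda>A::real ^ 'n ^ 'n. det A \<noteq> 0 \<longrightarrow> (\<forall>g \<in> borel_measurable borel.
    ennreal \<bar>det A\<bar> * (\<integral>\<^sup>+x. g (A *v x) \<partial>lborel) = (\<integral>\<^sup>+x. g x \<partial>lborel))"
  have "?P A"
  proof (rule induct_matrix_elementary)
    fix A B :: "real ^ 'n ^ 'n"
    assume A: "?P A" and B: "?P B"
    show "?P (A ** B)"
    proof (intro impI ballI)
      fix g :: "real ^ 'n \<Rightarrow> ennreal"
      assume nz: "det (A ** B) \<noteq> 0" and [measurable]: "g \<in> borel_measurable borel"
      have "ennreal \<bar>det (A ** B)\<bar> * (\<integral>\<^sup>+x. g ((A ** B) *v x) \<partial>lborel)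
        = ennreal \<bar>det A\<bar> * (ennreal \<bar>det B\<bar> * (\<integral>\<^sup>+x. g (A *v (B *v x)) \<partial>lborel))"
        by (simp add: det_mul abs_mult ennreal_mult matrix_vector_mul_assoc mult.assoc)
      also have "ennreal \<bar>det B\<bar> * (\<integral>\<^sup>+x. g (A *v (B *v x)) \<partial>lborel) = (\<integral>\<^sup>+x. g (A *v x) \<partial>lborel)"
        using B nz by (auto simp: det_mul)
      also have "ennreal \<bar>det A\<bar> * \<dots> = (\<integral>\<^sup>+x. g x \<partial>lborel)"
        using A nz by (auto simp: det_mul)
      finally show "ennreal \<bar>det (A ** B)\<bar> * (\<integral>\<^sup>+x. g ((A ** B) *v x) \<partial>lborel) = (\<integral>\<^sup>+x. g x \<partial>lborel)" .
    qed
  next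
    fix A :: "real ^ 'n ^ 'n" and i
    assume "row i A = 0"
    then show "?P A" by (simp add: det_zero_row)
  next
    fix A :: "real ^ 'n ^ 'n"
    assume diag: "\<And>i j. i \<noteq> j \<Longrightarrow> A $ i $ j = 0"
    then have detA: "det A = (\<Prod>i\<in>UNIV. A $ i $ i)" by (rule det_diagonal)
    show "?P A"
    proof (intro impI ballI)
      fix g :: "real ^ 'n \<Rightarrow> ennreal"
      assume nz: "det A \<noteq> 0" and [measurable]: "g \<in> borel_measurable borel"
      \<comment> \<open>The diagonal entries are indexed by basis vectors, the form in which
        \<open>lborel_affine_euclidean\<close> takes its scaling factors.\<close>
      define c where "c b = b \<bullet> (A *v b)" for b
      have c_axis: "c (axis i 1) = A $ i $ i" for i
        by (simp add: c_def inner_axis' matrix_vector_mult_basis column_def)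
      have eq: "A *v x = 0 + (\<Sum>j\<in>Basis. (c j * (x \<bullet> j)) *\<^sub>R j)" for x
      proof (subst vec_eq_iff, rule allI)
        fix k
        have "(A *v x) $ k = A $ k $ k * x $ k"
          unfolding matrix_vector_mult_def
          by (simp, subst sum.remove[of _ k]) (auto simp: diag intro!: sum.neutral)
        moreover have "(\<Sum>i\<in>UNIV. A $ i $ i * x $ i * axis i 1 $ k) = A $ k $ k * x $ k"
          by (subst sum.remove[of _ k]) (auto simp: axis_def intro!: sum.neutral)
        ultimately show "(A *v x) $ k = (0 + (\<Sum>j\<in>Basis. (c j * (x \<bullet> j)) *\<^sub>R j)) $ k"
          by (simp add: sum_Basis_cart c_axis inner_axis)
      qed
      have c0: "c j \<noteq> 0" if "j \<in> Basis" for j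
        using that nz by (auto simp: Basis_vec_def c_axis detA)
      have "lborel = density (distr lborel borel (\<lambda>x. A *v x)) (\<lambda>_. \<Prod>j\<in>Basis. \<bar>c j\<bar>)"
        unfolding eq by (rule lborel_affine_euclidean[OF c0])
      also have "(\<Prod>j\<in>Basis. \<bar>c j\<bar>) = \<bar>det A\<bar>"
        by (simp add: prod_Basis_cart c_axis detA abs_prod)
      finally have "(\<integral>\<^sup>+x. g x \<partial>lborel) =
          (\<integral>\<^sup>+x. g x \<partial>density (distr lborel borel (\<lambda>x. A *v x)) (\<lambda>_. ennreal \<bar>det A\<bar>))" by simp
      also have "\<dots> = ennreal \<bar>det A\<bar> * (\<integral>\<^sup>+x. g (A *v x) \<partial>lborel)"
        by (simp add: nn_integral_density nn_integral_distr nn_integral_cmult)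
      finally show "ennreal \<bar>det A\<bar> * (\<integral>\<^sup>+x. g (A *v x) \<partial>lborel) = (\<integral>\<^sup>+x. g x \<partial>lborel)" by simp
    qed
  next
    fix m n :: 'n assume "m \<noteq> n"
    let ?t = "Transposition.transpose m n"
    let ?A = "\<chi> i j. mat 1 $ i $ ?t j :: real ^ 'n ^ 'n"
    have perm: "?t permutes UNIV" by (simp add: permutes_swap_id)
    have tt[simp]: "?t (?t k) = k" for k by (simp add: transpose_involutory)
    have det1: "\<bar>det ?A\<bar> = 1"
      by (simp add: det_permute_columns[OF perm] sign_swap_id abs_mult)
    have mult: "?A *v x = (\<chi> i. x $ ?t i)" for x :: "real ^ 'n"
    proof (subst vec_eq_iff, rule allI)
      fix k
      have "(\<Sum>j\<in>UNIV. (if k = ?t j then 1 else 0) * x $ j) = (\<Sum>j\<in>UNIV. if j = ?t k then x $ j else 0)"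
        by (rule sum.cong) (auto simp: tt dest: arg_cong[where f = ?t])
      then show "(?A *v x) $ k = (\<chi> i. x $ ?t i) $ k"
        by (simp add: matrix_vector_mult_def mat_def)
    qed
    \<comment> \<open>Permuting coordinates sends boxes to boxes and only reorders the product of
      side lengths.\<close>
    have inv: "lborel = distr lborel borel (\<lambda>x::real ^ 'n. \<chi> i. x $ ?t i)"
    proof (rule lborel_eqI)
      fix l u :: "real ^ 'n" assume le: "\<And>b. b \<in> Basis \<Longrightarrow> l \<bullet> b \<le> u \<bullet> b"
      then have le': "l $ i \<le> u $ i" for i
        using le[of "axis i 1"] by (simp add: inner_axis axis_in_Basis_iff)
      have "(\<lambda>x. \<chi> i. x $ ?t i) -` box l u = box (\<chi> i. l $ ?t i) (\<chi> i. u $ ?t i)"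
      proof (intro set_eqI iffI)
        fix x assume "x \<in> (\<lambda>x. \<chi> i. x $ ?t i) -` box l u"
        then have "l $ i < x $ ?t i \<and> x $ ?t i < u $ i" for i by (auto simp: mem_box_cart)
        from this[of "?t i" for i] show "x \<in> box (\<chi> i. l $ ?t i) (\<chi> i. u $ ?t i)"
          by (simp add: mem_box_cart)
      next
        fix x assume "x \<in> box (\<chi> i. l $ ?t i) (\<chi> i. u $ ?t i)"
        then have "l $ ?t i < x $ i \<and> x $ i < u $ ?t i" for i by (auto simp: mem_box_cart)
        from this[of "?t i" for i] show "x \<in> (\<lambda>x. \<chi> i. x $ ?t i) -` box l u"
          by (simp add: mem_box_cart)
      qed
      then have "emeasure (distr lborel borel (\<lambda>x. \<chi> i. x $ ?t i)) (box l u)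
          = emeasure lborel (box (\<chi> i. l $ ?t i) (\<chi> i. u $ ?t i))"
        by (subst emeasure_distr) auto
      also have "\<dots> = (\<Prod>i\<in>UNIV. u $ ?t i - l $ ?t i)"
        by (subst emeasure_lborel_box)
           (simp_all add: prod_Basis_cart inner_axis, auto simp: Basis_vec_def inner_axis le')
      also have "\<dots> = (\<Prod>i\<in>UNIV. u $ i - l $ i)"
        using prod.permute[OF perm, of "\<lambda>i. u $ i - l $ i"] by (simp add: o_def)
      finally show "emeasure (distr lborel borel (\<lambda>x. \<chi> i. x $ ?t i)) (box l u)
          = (\<Prod>b\<in>Basis. (u - l) \<bullet> b)"
        by (simp add: prod_Basis_cart inner_axis)
    qed auto
    show "?P ?A"
    proof (intro impI ballI)
      fix g :: "real ^ 'n \<Rightarrow> ennreal"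
      assume [measurable]: "g \<in> borel_measurable borel"
      show "ennreal \<bar>det ?A\<bar> * (\<integral>\<^sup>+x. g (?A *v x) \<partial>lborel) = (\<integral>\<^sup>+x. g x \<partial>lborel)"
        by (subst (2) inv) (simp add: nn_integral_distr det1 mult)
    qed
  next
    fix m n :: 'n and c :: real assume "m \<noteq> n"
    let ?A = "\<chi> i j. if i = m \<and> j = n then c else of_bool (i = j) :: real ^ 'n ^ 'n"
    have "?A = (\<chi> k. if k = m then row m (mat 1) + c *s row n (mat 1) else row k (mat 1))"
      using \<open>m \<noteq> n\<close> by (auto simp: vec_eq_iff row_def mat_def)
    then have det1: "det ?A = 1"
      using det_row_operation[OF \<open>m \<noteq> n\<close>, of "mat 1" c] by simp
    have mult: "?A *v x = (c * x $ n) *\<^sub>R axis m 1 + x" for x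
    proof (subst vec_eq_iff, rule allI)
      fix k
      have "(\<Sum>j\<in>UNIV. (if k = m \<and> j = n then c else of_bool (k = j)) * x $ j)
        = (\<Sum>j\<in>UNIV. (if j = n then (if k = m then c * x $ j else 0) else 0) + (if j = k then x $ j else 0))"
        using \<open>m \<noteq> n\<close> by (intro sum.cong) auto
      also have "\<dots> = (if k = m then c * x $ n else 0) + x $ k"
        by (subst sum.distrib) simp
      finally show "(?A *v x) $ k = ((c * x $ n) *\<^sub>R axis m 1 + x) $ k"
        by (simp add: matrix_vector_mult_def axis_def)
    qed
    show "?P ?A"
    proof (intro impI ballI)
      fix g :: "real ^ 'n \<Rightarrow> ennreal"
      assume [measurable]: "g \<in> borel_measurable borel"
      have "(\<integral>\<^sup>+x. g ((c * x $ n) *\<^sub>R axis m 1 + x) \<partial>lborel) = (\<integral>\<^sup>+x. g x \<partial>lborel)"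
        (is "?l = ?r")
      proof -
        \<comment> \<open>Since \<open>m\<close> differs from \<open>n\<close>, the coordinate
          \<open>x $ n\<close> is constant along the line, and there the shear is a translation by
          \<open>c * x $ n\<close>.\<close>
        have fibre: "(\<integral>\<^sup>+s. g ((c * (s *\<^sub>R axis m 1 + x) $ n) *\<^sub>R axis m 1 + (s *\<^sub>R axis m 1 + x)) \<partial>lborel)
          = (\<integral>\<^sup>+s. g (s *\<^sub>R axis m 1 + x) \<partial>lborel)" for x
        proof -
          have "(\<integral>\<^sup>+s. g ((c * (s *\<^sub>R axis m 1 + x) $ n) *\<^sub>R axis m 1 + (s *\<^sub>R axis m 1 + x)) \<partial>lborel)
            = (\<integral>\<^sup>+s. g ((c * x $ n + s) *\<^sub>R axis m 1 + x) \<partial>lborel)"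
            using \<open>m \<noteq> n\<close> by (intro nn_integral_cong) (simp add: axis_def algebra_simps)
          also have "\<dots> = (\<integral>\<^sup>+s. g (s *\<^sub>R axis m 1 + x) \<partial>lborel)"
            by (rule nn_integral_lborel_translate[where f = "\<lambda>s. g (s *\<^sub>R axis m 1 + x)"]) measurable
          finally show ?thesis .
        qed
        have "?l = (\<integral>\<^sup>+x. indicator {0..1} (- x $ m) * (\<integral>\<^sup>+s. g (s *\<^sub>R axis m 1 + x) \<partial>lborel) \<partial>lborel)"
          by (subst nn_integral_lborel_fibre[where m = m]) (simp_all only: fibre, measurable)
        also have "\<dots> = ?r" by (rule nn_integral_lborel_fibre[symmetric]) measurable
        finally show ?thesis .
      qed
      then show "ennreal \<bar>det ?A\<bar> * (\<integral>\<^sup>+x. g (?A *v x) \<partial>lborel) = (\<integral>\<^sup>+x. g x \<partial>lborel)"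
        by (simp add: det1 mult)
    qed
  qed
  then show ?thesis using assms by blast
qed

section \<open>Positive definite matrices\<close>

lemma posdef_coneD:
  assumes "s \<in> posdef_cone"
  shows "transpose s = s" "x \<noteq> 0 \<Longrightarrow> 0 < x \<bullet> (s *v x)" "0 \<le> x \<bullet> (s *v x)"
  using assms by (auto simp: posdef_cone_def) (metis inner_zero_left less_eq_real_def)

lemma inner_matrix_vector_mult_right:
  fixes A :: "real ^ 'n ^ 'm"
  shows "x \<bullet> (A *v y) = (transpose A *v x) \<bullet> y"
  by (simp add: dot_lmul_matrix)

lemma inner_transpose_matrix_vector_mult:
  fixes A :: "real ^ 'n ^ 'm"
  shows "x \<bullet> (transpose A *v y) = (A *v x) \<bullet> y"
  using inner_matrix_vector_mult_right[of x "transpose A" y] by (simp only: transpose_transpose)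

text \<open>Gram-Schmidt for the scalar product \<open>x \<bullet> (s *v y)\<close>. Fewer than
  \<open>CARD('n)\<close> images \<open>s *v b\<close> leave a nonzero vector \<open>w\<close>
  orthogonal to all of them in the Euclidean sense; it is then \<open>s\<close>-orthogonal to the
  vectors already found and only has to be normalised.\<close>

lemma posdef_cone_orthonormal_set:
  fixes s :: "real ^ 'n ^ 'n"
  assumes s: "s \<in> posdef_cone" and "k \<le> CARD('n)"
  shows "\<exists>B. finite B \<and> card B = k \<and> (\<forall>b\<in>B. \<forall>c\<in>B. b \<bullet> (s *v c) = (if b = c then 1 else 0))"
  using assms(2)
proof (induction k)
  case 0
  then show ?case by (intro exI[of _ "{}"]) auto
next
  case (Suc k)
  then obtain B where B: "finite B" "card B = k"
    and orth: "\<And>b c. b \<in> B \<Longrightarrow> c \<in> B \<Longrightarrow> b \<bullet> (s *v c) = (if b = c then 1 else 0)" by auto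
  have "dim ((*v) s ` B) \<le> card ((*v) s ` B)" using B by (intro dim_le_card') auto
  also have "\<dots> \<le> card B" using B by (intro card_image_le)
  also have "\<dots> < DIM(real ^ 'n)" using B Suc.prems by simp
  finally obtain w where w: "w \<noteq> 0" "\<And>y. y \<in> span ((*v) s ` B) \<Longrightarrow> orthogonal w y"
    using orthogonal_to_subspace_exists by blast
  have w0: "w \<bullet> (s *v b) = 0" if "b \<in> B" for b
    using w(2)[of "s *v b"] that by (auto simp: orthogonal_def intro: span_base)
  have sym: "b \<bullet> (s *v c) = c \<bullet> (s *v b)" for b c
    using posdef_coneD(1)[OF s] by (metis inner_matrix_vector_mult_right inner_commute)
  define r where "r = w \<bullet> (s *v w)"
  have r: "r > 0" using posdef_coneD(2)[OF s w(1)] by (simp add: r_def)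
  define v where "v = (1 / sqrt r) *\<^sub>R w"
  have vv: "v \<bullet> (s *v v) = 1"
    using r by (simp add: v_def matrix_vector_mult_scaleR r_def[symmetric])
  have vb: "v \<bullet> (s *v b) = 0" "b \<bullet> (s *v v) = 0" if "b \<in> B" for b
    using w0[OF that] sym[of b v] by (simp_all add: v_def)
  have "v \<notin> B" using vb vv by force
  show ?case
  proof (intro exI[of _ "insert v B"] conjI ballI)
    show "card (insert v B) = Suc k" using B \<open>v \<notin> B\<close> by simp
    show "b \<bullet> (s *v c) = (if b = c then 1 else 0)" if "b \<in> insert v B" "c \<in> insert v B" for b c
      using that vv vb orth \<open>v \<notin> B\<close> by (auto split: if_splits)
  qed (use B in auto)
qed

text \<open>The columns of \<open>A\<close> are a full \<open>s\<close>-orthonormal set. This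
  congruence does the work of a matrix square root when \<open>s\<close> is reduced to the
  identity.\<close>

lemma posdef_cone_congruent_id:
  fixes s :: "real ^ 'n ^ 'n"
  assumes s: "s \<in> posdef_cone"
  obtains A :: "real ^ 'n ^ 'n" where "transpose A ** s ** A = mat 1"
proof -
  obtain B where B: "finite B" "card B = CARD('n)"
    and orth: "\<And>b c. b \<in> B \<Longrightarrow> c \<in> B \<Longrightarrow> b \<bullet> (s *v c) = (if b = c then 1 else 0)"
    using posdef_cone_orthonormal_set[OF s order_refl] by blast
  obtain \<beta> :: "'n \<Rightarrow> real ^ 'n" where \<beta>: "bij_betw \<beta> UNIV B"
    using finite_same_card_bij[of "UNIV :: 'n set" B] B by auto
  define A where "A = (\<chi> i j. \<beta> j $ i)"
  have "(transpose A ** s ** A) $ i $ j = mat 1 $ i $ j" for i j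
  proof -
    have "(transpose A ** s ** A) $ i $ j = (transpose A ** (s ** A)) $ i $ j"
      by (simp add: matrix_mul_assoc)
    also have "\<dots> = \<beta> i \<bullet> (s *v \<beta> j)"
      by (simp add: matrix_matrix_mult_def matrix_vector_mult_def transpose_def A_def inner_vec_def)
    also have "\<dots> = mat 1 $ i $ j"
      using orth[of "\<beta> i" "\<beta> j"] \<beta> by (auto simp: mat_def bij_betw_def inj_eq)
    finally show ?thesis .
  qed
  then show thesis by (intro that[of A]) (simp add: vec_eq_iff)
qed

lemma posdef_cone_congruent_det:
  fixes A :: "real ^ 'n ^ 'n"
  assumes "transpose A ** s ** A = mat 1"
  shows "det A \<noteq> 0" "det s = 1 / (det A)\<^sup>2"
proof -
  have "det (transpose A ** s ** A) = 1" by (simp add: assms)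
  then have *: "det s * (det A)\<^sup>2 = 1" by (simp add: det_mul power2_eq_square mult_ac)
  then show "det A \<noteq> 0" by auto
  with * show "det s = 1 / (det A)\<^sup>2" by (simp add: field_simps)
qed

lemma posdef_cone_congruent_quadratic:
  fixes A s :: "real ^ 'n ^ 'n"
  assumes "transpose A ** s ** A = mat 1"
  shows "(A *v x) \<bullet> (s *v (A *v x)) = x \<bullet> x"
proof -
  have "(A *v x) \<bullet> (s *v (A *v x)) = x \<bullet> (transpose A *v (s *v (A *v x)))"
    by (simp only: inner_transpose_matrix_vector_mult)
  also have "\<dots> = x \<bullet> ((transpose A ** s ** A) *v x)"
    by (simp only: matrix_vector_mul_assoc matrix_mul_assoc)
  finally show ?thesis by (simp add: assms)
qed

lemma posdef_cone_det_pos: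
  fixes s :: "real ^ 'n ^ 'n"
  assumes "s \<in> posdef_cone"
  shows "det s > 0"
proof -
  obtain A :: "real ^ 'n ^ 'n" where "transpose A ** s ** A = mat 1" using posdef_cone_congruent_id[OF assms] .
  from posdef_cone_congruent_det[OF this] show ?thesis by simp
qed

lemma posdef_cone_add:
  assumes "s \<in> posdef_cone" "t \<in> posdef_cone"
  shows "s + t \<in> posdef_cone"
proof -
  have "transpose (s + t) = s + t"
    using posdef_coneD(1)[OF assms(1)] posdef_coneD(1)[OF assms(2)]
    by (simp add: transpose_def vec_eq_iff)
  then show ?thesis
    using posdef_coneD(2)[OF assms(1)] posdef_coneD(2)[OF assms(2)]
    by (auto simp: posdef_cone_def matrix_vector_mult_add_rdistrib inner_add_right intro: add_pos_pos)
qed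

lemma posdef_cone_id: "mat 1 \<in> posdef_cone"
  by (simp add: posdef_cone_def transpose_mat)

lemma posdef_cone_gram:
  fixes R :: "real ^ 'n ^ 'n"
  assumes "det R \<noteq> 0"
  shows "transpose R ** R \<in> posdef_cone"
proof -
  have "R *v x \<noteq> 0" if "x \<noteq> 0" for x
    using that assms by (metis invertible_det_nz invertible_def matrix_left_invertible_ker)
  then have "0 < x \<bullet> ((transpose R ** R) *v x)" if "x \<noteq> 0" for x
    using that by (simp only: matrix_vector_mul_assoc[symmetric] inner_transpose_matrix_vector_mult
        inner_gt_zero_iff)
  then show ?thesis by (simp add: posdef_cone_def matrix_transpose_mul transpose_transpose)
qed

lemma matrix_inv_invertible:
  assumes "invertible A"
  shows "A ** matrix_inv A = mat 1" "matrix_inv A ** A = mat 1"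
  using someI_ex[OF assms[unfolded invertible_def]] by (simp_all add: matrix_inv_def)

lemma matrix_inv_posdef_cone:
  fixes s :: "real ^ 'n ^ 'n"
  assumes s: "s \<in> posdef_cone"
  shows "s ** matrix_inv s = mat 1" "matrix_inv s ** s = mat 1" "matrix_inv s \<in> posdef_cone"
    "det (matrix_inv s) = 1 / det s" "matrix_inv (matrix_inv s) = s"
proof -
  have inv: "invertible s" using posdef_cone_det_pos[OF s] by (simp add: invertible_det_nz)
  then show l: "s ** matrix_inv s = mat 1" and r: "matrix_inv s ** s = mat 1"
    by (simp_all add: matrix_inv_invertible)
  show "matrix_inv (matrix_inv s) = s" 
    by (metis l r invertible_def matrix_inv_invertible(1) matrix_mul_assoc matrix_mul_lid matrix_mul_rid)
  have "det (s ** matrix_inv s) = 1" by (simp add: l)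
  then show "det (matrix_inv s) = 1 / det s"
    using posdef_cone_det_pos[OF s] by (simp add: det_mul field_simps)
  obtain A :: "real ^ 'n ^ 'n" where A: "transpose A ** s ** A = mat 1" using posdef_cone_congruent_id[OF s] .
  \<comment> \<open>Moving \<open>A\<close> to the other side shows that the inverse of
    \<open>s\<close> is \<open>A A^T\<close>, the Gram matrix of \<open>A^T\<close>, hence positive
    definite.\<close>
  have "A ** transpose A ** s = mat 1"
    using A matrix_left_right_inverse[of "transpose A ** s" A] by (simp add: matrix_mul_assoc)
  then have "matrix_inv s = A ** transpose A"
    by (metis l matrix_mul_assoc matrix_mul_lid matrix_mul_rid)
  moreover have "det (transpose A) \<noteq> 0" using posdef_cone_congruent_det(1)[OF A] by simp
  ultimately show "matrix_inv s \<in> posdef_cone"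
    using posdef_cone_gram[of "transpose A"] by (simp add: transpose_transpose)
qed

text \<open>Reducing the inverse of \<open>s\<close>, rather than \<open>s\<close>, to the identity
  makes \<open>s\<close> itself the product \<open>A ** transpose A\<close>.\<close>

lemma posdef_cone_factor:
  fixes s :: "real ^ 'n ^ 'n"
  assumes s: "s \<in> posdef_cone"
  obtains A :: "real ^ 'n ^ 'n" where "s = A ** transpose A" "det A \<noteq> 0"
    "transpose A ** matrix_inv s ** A = mat 1"
proof -
  note inv = matrix_inv_posdef_cone[OF s]
  obtain A :: "real ^ 'n ^ 'n" where A: "transpose A ** matrix_inv s ** A = mat 1"
    using posdef_cone_congruent_id[OF inv(3)] .
  have "A ** transpose A ** matrix_inv s = mat 1"
    using A matrix_left_right_inverse[of "transpose A ** matrix_inv s" A] by (simp add: matrix_mul_assoc)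
  then have "s = A ** transpose A"
    by (metis inv(2) matrix_mul_assoc matrix_mul_lid matrix_mul_rid)
  then show thesis using that posdef_cone_congruent_det(1)[OF A] A by blast
qed

section \<open>Rank one perturbations and trace identities\<close>

definition outer :: "real ^ 'n \<Rightarrow> real ^ 'n ^ 'n" where
  "outer x = (\<chi> i j. x $ i * x $ j)"

lemma outer_mult_vector: "outer x *v y = (x \<bullet> y) *\<^sub>R x"
  by (simp add: outer_def matrix_vector_mult_def inner_vec_def vec_eq_iff sum_distrib_left
      sum_distrib_right mult_ac)

lemma transpose_outer: "transpose (outer x) = outer x"
  by (simp add: outer_def transpose_def vec_eq_iff mult.commute)

lemma outer_matrix_vector_mult: "outer (A *v x) = A ** outer x ** transpose A"
proof (subst matrix_eq, rule allI)
  fix y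
  have "(A ** outer x ** transpose A) *v y = A *v (outer x *v (transpose A *v y))"
    by (simp only: matrix_vector_mul_assoc matrix_mul_assoc)
  also have "\<dots> = (x \<bullet> (transpose A *v y)) *\<^sub>R (A *v x)"
    by (simp only: outer_mult_vector matrix_vector_mult_scaleR)
  also have "x \<bullet> (transpose A *v y) = (A *v x) \<bullet> y"
    by (rule inner_transpose_matrix_vector_mult)
  finally show "outer (A *v x) *v y = (A ** outer x ** transpose A) *v y"
    by (simp add: outer_mult_vector)
qed

lemma posdef_cone_add_outer:
  assumes s: "s \<in> posdef_cone"
  shows "s + outer x \<in> posdef_cone"
proof -
  have "transpose (s + outer x) = s + outer x"
    using posdef_coneD(1)[OF s] transpose_outer[of x]
    by (simp add: transpose_def vec_eq_iff)
  moreover have "0 < y \<bullet> ((s + outer x) *v y)" if "y \<noteq> 0" for y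
    using posdef_coneD(2)[OF s that]
    by (simp add: matrix_vector_mult_add_rdistrib inner_add_right outer_mult_vector
        inner_commute[of y x] add_pos_nonneg)
  ultimately show ?thesis by (simp add: posdef_cone_def)
qed

lemma matrix_add_mult_distrib:
  fixes A B :: "real ^ 'n ^ 'm"
  shows "(A + B) ** C = A ** C + B ** C"
  by (simp add: matrix_matrix_mult_def vec_eq_iff sum.distrib algebra_simps)

text \<open>An orthogonal matrix carries a multiple of a coordinate axis to \<open>x\<close>. In the
  rotated coordinates the matrix is diagonal, with one entry \<open>1 + x \<bullet> x\<close> and
  all others 1.\<close>

lemma det_id_add_outer:
  fixes x :: "real ^ 'n"
  shows "det (mat 1 + outer x) = 1 + x \<bullet> x"
proof -
  obtain k :: 'n where True by simp
  have "norm (norm x *\<^sub>R axis k 1 :: real ^ 'n) = norm x" by simp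
  then obtain f :: "real ^ 'n \<Rightarrow> real ^ 'n" where f: "orthogonal_transformation f" "f (norm x *\<^sub>R axis k 1) = x"
    by (rule orthogonal_transformation_exists) blast
  define Q where "Q = matrix f"
  have Q: "orthogonal_matrix Q" "Q *v (norm x *\<^sub>R axis k 1) = x"
    using f by (auto simp: Q_def orthogonal_transformation_matrix)
  let ?D = "mat 1 + outer (norm x *\<^sub>R axis k 1) :: real ^ 'n ^ 'n"
  have "mat 1 + outer x = Q ** ?D ** transpose Q"
    using Q outer_matrix_vector_mult[of Q "norm x *\<^sub>R axis k 1"]
    by (simp add: matrix_add_ldistrib matrix_add_mult_distrib orthogonal_matrix_def)
  then have "det (mat 1 + outer x) = (det Q)\<^sup>2 * det ?D"
    by (simp add: det_mul power2_eq_square)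
  also have "(det Q)\<^sup>2 = 1" using det_orthogonal_matrix[OF Q(1)] by auto
  also have "det ?D = (\<Prod>i\<in>UNIV. ?D $ i $ i)"
    by (rule det_diagonal) (auto simp: mat_def outer_def axis_def)
  also have "\<dots> = 1 + x \<bullet> x"
    by (subst prod.remove[of _ k])
       (auto simp: mat_def outer_def axis_def dot_square_norm power2_eq_square intro!: prod.neutral)
  finally show ?thesis by simp
qed

text \<open>The matrix determinant lemma: with \<open>s = A A^T\<close> and \<open>x = A y\<close>,
  the factor \<open>A\<close> splits off on both sides and leaves the case of the identity.\<close>

lemma det_posdef_cone_add_outer:
  fixes s :: "real ^ 'n ^ 'n"
  assumes s: "s \<in> posdef_cone"
  shows "det (s + outer x) = det s * (1 + x \<bullet> (matrix_inv s *v x))"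
proof -
  obtain A :: "real ^ 'n ^ 'n" where sA: "s = A ** transpose A" and detA: "det A \<noteq> 0"
    and A: "transpose A ** matrix_inv s ** A = mat 1"
    using posdef_cone_factor[OF s] .
  define y where "y = matrix_inv A *v x"
  have xy: "x = A *v y"
    using detA by (simp add: y_def matrix_vector_mul_assoc matrix_inv_invertible invertible_det_nz)
  have "s + outer x = A ** (mat 1 + outer y) ** transpose A"
    by (simp add: sA xy outer_matrix_vector_mult matrix_add_ldistrib matrix_add_mult_distrib)
  then have "det (s + outer x) = det s * (1 + y \<bullet> y)"
    by (simp add: det_mul sA det_id_add_outer)
  also have "y \<bullet> y = x \<bullet> (matrix_inv s *v x)"
    using posdef_cone_congruent_quadratic[OF A, of y] by (simp add: xy)
  finally show ?thesis .
qed

text \<open>Splits the exponent of the density of \<open>R\<close> into one quadratic form per row,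
  all with the same matrix \<open>s\<close>.\<close>

lemma trace_mult_gram:
  fixes s R :: "real ^ 'n ^ 'n"
  shows "trace (s ** (transpose R ** R)) = (\<Sum>i\<in>UNIV. R $ i \<bullet> (s *v R $ i))"
proof -
  have "trace (s ** (transpose R ** R)) = (\<Sum>j\<in>UNIV. \<Sum>k\<in>UNIV. \<Sum>i\<in>UNIV. s $ j $ k * (R $ i $ k * R $ i $ j))"
    by (simp add: trace_def matrix_matrix_mult_def transpose_def sum_distrib_left)
  also have "\<dots> = (\<Sum>j\<in>UNIV. \<Sum>i\<in>UNIV. \<Sum>k\<in>UNIV. s $ j $ k * (R $ i $ k * R $ i $ j))"
    by (intro sum.cong refl sum.swap)
  also have "\<dots> = (\<Sum>i\<in>UNIV. \<Sum>j\<in>UNIV. \<Sum>k\<in>UNIV. s $ j $ k * (R $ i $ k * R $ i $ j))"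
    by (rule sum.swap)
  also have "\<dots> = (\<Sum>i\<in>UNIV. R $ i \<bullet> (s *v R $ i))"
    by (simp add: inner_vec_def matrix_vector_mult_def sum_distrib_left sum_distrib_right mult_ac)
  finally show ?thesis .
qed

text \<open>Writing \<open>u\<close> as a Gram matrix turns the trace into a sum of values of the
  quadratic form of \<open>s\<close>. Consequently \<open>exp (- trace (s ** u))\<close> is at most
  1 on the cone.\<close>

lemma trace_mult_posdef_cone_nonneg:
  fixes s u :: "real ^ 'n ^ 'n"
  assumes s: "s \<in> posdef_cone" and u: "u \<in> posdef_cone"
  shows "0 \<le> trace (s ** u)"
proof -
  obtain A :: "real ^ 'n ^ 'n" where A: "u = A ** transpose A" using posdef_cone_factor[OF u] .
  then have "trace (s ** u) = (\<Sum>i\<in>UNIV. transpose A $ i \<bullet> (s *v transpose A $ i))"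
    using trace_mult_gram[of s "transpose A"] by (simp add: transpose_transpose)
  then show ?thesis using posdef_coneD(3)[OF s] by (simp add: sum_nonneg)
qed

lemma trace_outer_mult:
  fixes u :: "real ^ 'n ^ 'n"
  shows "trace (outer x ** u) = x \<bullet> (u *v x)"
proof -
  have "trace (outer x ** u) = (\<Sum>i\<in>UNIV. \<Sum>k\<in>UNIV. x $ k * u $ k $ i * x $ i)"
    by (simp add: trace_def outer_def matrix_matrix_mult_def mult_ac)
  also have "\<dots> = (\<Sum>k\<in>UNIV. \<Sum>i\<in>UNIV. x $ k * u $ k $ i * x $ i)"
    by (rule sum.swap)
  finally show ?thesis
    by (simp add: inner_vec_def matrix_vector_mult_def sum_distrib_left mult.assoc)
qed

text \<open>Both sides are the squared norm of \<open>R *v x\<close>. Read from left to right, a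
  Gaussian factor in \<open>x\<close> becomes a shift of the matrix parameter by
  \<open>outer x\<close>.\<close>

lemma inner_gram_mult_vector:
  fixes R :: "real ^ 'n ^ 'n"
  shows "x \<bullet> ((transpose R ** R) *v x) = (\<Sum>i\<in>UNIV. R $ i \<bullet> (outer x *v R $ i))"
proof -
  have "x \<bullet> ((transpose R ** R) *v x) = (R *v x) \<bullet> (R *v x)"
    by (simp only: matrix_vector_mul_assoc[symmetric] inner_transpose_matrix_vector_mult)
  also have "\<dots> = (\<Sum>i\<in>UNIV. (R $ i \<bullet> x) * (R $ i \<bullet> x))"
    by (simp add: inner_vec_def matrix_vector_mult_def)
  finally show ?thesis by (simp add: outer_mult_vector inner_commute)
qed

section \<open>Gaussian integrals over vectors and matrices\<close>

lemma nn_integral_exp_neg_square: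
  fixes t :: real
  assumes t: "t > 0"
  shows "(\<integral>\<^sup>+x. ennreal (exp (- (t * x\<^sup>2))) \<partial>lborel) = ennreal (sqrt (pi / t))"
proof -
  \<comment> \<open>The standard deviation for which the exponent of the normal density is
    \<open>- t * x^2\<close>.\<close>
  define r where "r = sqrt (1 / (2 * t))"
  have r: "r > 0" "r\<^sup>2 = 1 / (2 * t)" using t by (auto simp: r_def)
  have "ennreal (exp (- (t * x\<^sup>2))) = ennreal (sqrt (pi / t)) * ennreal (normal_density 0 r x)" for x
    using t by (simp add: ennreal_mult[symmetric] normal_density_def r field_simps real_sqrt_divide)
  then have "(\<integral>\<^sup>+x. ennreal (exp (- (t * x\<^sup>2))) \<partial>lborel)
      = ennreal (sqrt (pi / t)) * (\<integral>\<^sup>+x. ennreal (normal_density 0 r x) \<partial>lborel)"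
    by (simp add: nn_integral_cmult)
  also have "(\<integral>\<^sup>+x. ennreal (normal_density 0 r x) \<partial>lborel) = 1"
    using r by (subst nn_integral_eq_integral) auto
  finally show ?thesis by simp
qed

lemma nn_integral_exp_neg_inner:
  fixes t :: real
  assumes t: "t > 0"
  shows "(\<integral>\<^sup>+x. ennreal (exp (- (t * (x \<bullet> x)))) \<partial>(lborel :: (real ^ 'n) measure))
    = ennreal ((pi / t) powr (real CARD('n) / 2))"
proof -
  have "ennreal (exp (- (t * (x \<bullet> x)))) = (\<Prod>b\<in>Basis. ennreal (exp (- (t * (x \<bullet> b)\<^sup>2))))"
    for x :: "real ^ 'n"
    by (simp add: prod_ennreal exp_sum[symmetric] sum_negf sum_distrib_left[symmetric]
        euclidean_inner[of x x] power2_eq_square)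
  then have "(\<integral>\<^sup>+x. ennreal (exp (- (t * (x \<bullet> x)))) \<partial>(lborel :: (real ^ 'n) measure))
    = (\<Prod>b\<in>(Basis :: (real ^ 'n) set). ennreal (sqrt (pi / t)))"
    by (simp add: nn_integral_lborel_prod[where f = "\<lambda>_ x. ennreal (exp (- (t * x\<^sup>2)))"]
        nn_integral_exp_neg_square[OF t])
  also have "\<dots> = ennreal (sqrt (pi / t) ^ CARD('n))"
    using t by (simp add: ennreal_power)
  also have "sqrt (pi / t) ^ CARD('n) = (pi / t) powr (real CARD('n) / 2)"
    using t by (simp add: powr_half_sqrt[symmetric] powr_power)
  finally show ?thesis .
qed

text \<open>The substitution by \<open>A\<close> with \<open>A^T u A = 1\<close> reduces to the
  standard Gaussian, and its Jacobian is \<open>1 / sqrt (det u)\<close>.\<close>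

lemma nn_integral_exp_neg_quadratic:
  fixes u :: "real ^ 'n ^ 'n"
  assumes u: "u \<in> posdef_cone"
  shows "(\<integral>\<^sup>+x. ennreal (exp (- (x \<bullet> (u *v x)))) \<partial>lborel)
    = ennreal (pi powr (real CARD('n) / 2) / sqrt (det u))"
proof -
  obtain A :: "real ^ 'n ^ 'n" where A: "transpose A ** u ** A = mat 1"
    using posdef_cone_congruent_id[OF u] .
  note detA = posdef_cone_congruent_det[OF A]
  note quad = posdef_cone_congruent_quadratic[OF A]
  have "(\<integral>\<^sup>+x. ennreal (exp (- (x \<bullet> (u *v x)))) \<partial>lborel)
      = ennreal \<bar>det A\<bar> * (\<integral>\<^sup>+x. ennreal (exp (- ((A *v x) \<bullet> (u *v (A *v x))))) \<partial>lborel)"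
    by (subst nn_integral_lborel_matrix[OF detA(1), symmetric]) auto
  also have "\<dots> = ennreal \<bar>det A\<bar> * ennreal (pi powr (real CARD('n) / 2))"
    using nn_integral_exp_neg_inner[of 1, where 'n = 'n] by (simp add: quad)
  also have "\<dots> = ennreal (pi powr (real CARD('n) / 2) / sqrt (det u))"
    by (simp add: ennreal_mult[symmetric] detA(2) real_sqrt_divide mult.commute)
  finally show ?thesis .
qed

text \<open>Lebesgue measure on square matrices, encoded as a product over the rows: the map taking
  \<open>R\<close> to \<open>R A^T\<close> then acts on every row separately by
  \<open>A\<close>.\<close>

abbreviation lborel_rows :: "('n::finite \<Rightarrow> real ^ 'n) measure" where
  "lborel_rows \<equiv> PiM UNIV (\<lambda>_. lborel)"

lemma product_sigma_finite_lborel: "product_sigma_finite (\<lambda>_. lborel)"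
  by standard

lemma sigma_finite_lborel_rows: "sigma_finite_measure lborel_rows"
  by (rule product_sigma_finite.sigma_finite[OF product_sigma_finite_lborel]) simp

lemma measurable_row [measurable]: "(\<lambda>f. f i) \<in> borel_measurable (lborel_rows :: ('n::finite \<Rightarrow> real ^ 'n) measure)"
  using measurable_component_singleton[of i UNIV "\<lambda>_. lborel :: (real ^ 'n) measure"] by simp

lemma measurable_into_lborel_rows:
  assumes "\<And>i. (\<lambda>x. f x i) \<in> borel_measurable M"
  shows "f \<in> M \<rightarrow>\<^sub>M lborel_rows"
  by (rule measurable_PiM_single') (use assms in auto)

text \<open>Each row contributes one factor \<open>|det A|\<close>. It suffices to compare the two
  measures on products of Borel sets, where the factors separate.\<close>

lemma nn_integral_lborel_rows_matrix:
  fixes A :: "real ^ 'n ^ 'n"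
  assumes A: "det A \<noteq> 0" and [measurable]: "g \<in> borel_measurable lborel_rows"
  shows "ennreal (\<bar>det A\<bar> ^ CARD('n)) * (\<integral>\<^sup>+f. g (\<lambda>i. A *v f i) \<partial>lborel_rows) = (\<integral>\<^sup>+f. g f \<partial>lborel_rows)"
proof -
  interpret product_sigma_finite "\<lambda>_::'n. lborel :: (real ^ 'n) measure"
    by (rule product_sigma_finite_lborel)
  have T[measurable]: "(\<lambda>f i. A *v f i) \<in> lborel_rows \<rightarrow>\<^sub>M lborel_rows"
    by (rule measurable_into_lborel_rows) measurable
  let ?D = "density (distr lborel_rows lborel_rows (\<lambda>f i. A *v f i)) (\<lambda>_. ennreal (\<bar>det A\<bar> ^ CARD('n)))"
  have "?D = lborel_rows"
  proof (rule PiM_eqI)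
    fix B :: "'n \<Rightarrow> (real ^ 'n) set"
    assume B: "\<And>i. i \<in> UNIV \<Longrightarrow> B i \<in> sets lborel"
    then have [measurable]: "B i \<in> sets borel" for i by simp
    have S: "Pi\<^sub>E UNIV B \<in> sets lborel_rows" using B by (intro sets_PiM_I_finite) auto
    have pre: "(*v) A -` B i \<in> sets lborel" for i
      using measurable_sets[of "(*v) A" borel borel "B i"] by simp
    have one: "ennreal \<bar>det A\<bar> * emeasure lborel ((*v) A -` B i) = emeasure lborel (B i)" for i
    proof -
      have "ennreal \<bar>det A\<bar> * (\<integral>\<^sup>+x. indicator (B i) (A *v x) \<partial>lborel) = (\<integral>\<^sup>+x. indicator (B i) x \<partial>lborel)"
        by (rule nn_integral_lborel_matrix[OF A]) measurable
      moreover have "(\<lambda>x. indicator (B i) (A *v x) :: ennreal) = indicator ((*v) A -` B i)"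
        by (auto simp: indicator_def)
      ultimately show ?thesis using pre by simp
    qed
    have "emeasure ?D (Pi\<^sub>E UNIV B) = ennreal (\<bar>det A\<bar> ^ CARD('n)) *
        emeasure (distr lborel_rows lborel_rows (\<lambda>f i. A *v f i)) (Pi\<^sub>E UNIV B)"
      using S by (subst emeasure_density) (auto simp: nn_integral_cmult)
    also have "emeasure (distr lborel_rows lborel_rows (\<lambda>f i. A *v f i)) (Pi\<^sub>E UNIV B)
        = emeasure lborel_rows (Pi\<^sub>E UNIV (\<lambda>i. (*v) A -` B i))"
      using S by (subst emeasure_distr) (auto simp: space_PiM PiE_def intro!: arg_cong2[where f = emeasure])
    also have "\<dots> = (\<Prod>i\<in>UNIV. emeasure lborel ((*v) A -` B i))"
      using pre by (intro emeasure_PiM) auto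
    also have "ennreal (\<bar>det A\<bar> ^ CARD('n)) * \<dots>
        = (\<Prod>i\<in>(UNIV :: 'n set). ennreal \<bar>det A\<bar> * emeasure lborel ((*v) A -` B i))"
      by (simp add: prod.distrib ennreal_power)
    also have "\<dots> = (\<Prod>i\<in>UNIV. emeasure lborel (B i))" by (simp add: one)
    finally show "emeasure ?D (Pi\<^sub>E UNIV B) = (\<Prod>i\<in>UNIV. emeasure lborel (B i))" .
  qed simp_all
  then have "(\<integral>\<^sup>+f. g f \<partial>lborel_rows) = (\<integral>\<^sup>+f. g f \<partial>?D)" by simp
  also have "\<dots> = ennreal (\<bar>det A\<bar> ^ CARD('n)) * (\<integral>\<^sup>+f. g (\<lambda>i. A *v f i) \<partial>lborel_rows)"
    by (simp add: nn_integral_density nn_integral_distr nn_integral_cmult)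
  finally show ?thesis by simp
qed

text \<open>For the matrix \<open>R\<close> with rows \<open>f i\<close>, the exponent is
  \<open>- tr (s R^T R)\<close> by \<open>trace_mult_gram\<close>.\<close>

definition row_weight :: "real \<Rightarrow> real ^ 'n ^ 'n \<Rightarrow> ('n \<Rightarrow> real ^ 'n) \<Rightarrow> real" where
  "row_weight a s f = exp (- (\<Sum>i\<in>UNIV. f i \<bullet> (s *v f i))) * \<bar>det (\<chi> i. f i)\<bar> powr a"

lemma row_weight_nonneg: "0 \<le> row_weight a s f"
  by (simp add: row_weight_def)

lemma measurable_row_weight [measurable]: "row_weight a s \<in> borel_measurable lborel_rows"
  unfolding row_weight_def[abs_def] by measurable

definition row_integral :: "real \<Rightarrow> real ^ 'n ^ 'n \<Rightarrow> ennreal" where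
  "row_integral a s = (\<integral>\<^sup>+f. ennreal (row_weight a s f) \<partial>lborel_rows)"

text \<open>Replacing each row by its image under \<open>A\<close>, where
  \<open>A^T s A = 1\<close>, turns \<open>s\<close> into the identity. The Jacobian contributes
  \<open>|det A|^n\<close> and the weight \<open>|det A|^a\<close>, while
  \<open>det s = |det A|^-2\<close>.\<close>

lemma row_integral_eq:
  fixes s :: "real ^ 'n ^ 'n"
  assumes s: "s \<in> posdef_cone"
  shows "row_integral a s = ennreal (det s powr (- (a + real CARD('n)) / 2)) * row_integral a (mat 1 :: real ^ 'n ^ 'n)"
proof -
  obtain A :: "real ^ 'n ^ 'n" where A: "transpose A ** s ** A = mat 1"
    using posdef_cone_congruent_id[OF s] .
  note detA = posdef_cone_congruent_det[OF A]
  note quad = posdef_cone_congruent_quadratic[OF A]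
  have det: "det (\<chi> i. A *v f i) = det A * det (\<chi> i. f i)" for f
  proof -
    have "(\<chi> i. A *v f i) = (\<chi> i. f i) ** transpose A"
      by (simp add: vec_eq_iff matrix_matrix_mult_def matrix_vector_mult_def transpose_def mult.commute)
    then show ?thesis by (simp add: det_mul)
  qed
  have weight: "row_weight a s (\<lambda>i. A *v f i) = \<bar>det A\<bar> powr a * row_weight a (mat 1) f" for f
    by (simp add: row_weight_def quad det abs_mult powr_mult)
  have "row_integral a s
      = ennreal (\<bar>det A\<bar> ^ CARD('n)) * (\<integral>\<^sup>+f. ennreal (row_weight a s (\<lambda>i. A *v f i)) \<partial>lborel_rows)"
    unfolding row_integral_def
    by (rule nn_integral_lborel_rows_matrix[OF detA(1), symmetric]) measurable
  also have "\<dots> = ennreal (\<bar>det A\<bar> ^ CARD('n)) * (ennreal (\<bar>det A\<bar> powr a) * row_integral a (mat 1 :: real ^ 'n ^ 'n))"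
    by (simp add: weight ennreal_mult row_weight_nonneg nn_integral_cmult row_integral_def)
  also have "\<dots> = ennreal (\<bar>det A\<bar> ^ CARD('n) * \<bar>det A\<bar> powr a) * row_integral a (mat 1 :: real ^ 'n ^ 'n)"
    by (simp add: ennreal_mult mult.assoc)
  also have "\<bar>det A\<bar> ^ CARD('n) * \<bar>det A\<bar> powr a = \<bar>det A\<bar> powr (a + real CARD('n))"
    using detA(1) by (simp add: powr_add powr_realpow mult.commute)
  also have "\<dots> = det s powr (- (a + real CARD('n)) / 2)"
  proof -
    have "det s = \<bar>det A\<bar> powr (- 2)"
      using detA by (simp add: powr_minus_divide powr_realpow[of _ 2, simplified])
    then show ?thesis by (simp add: powr_powr add_divide_distrib add.commute)
  qed
  finally show ?thesis .
qed

text \<open>With \<open>q = b + n / 2\<close>, the power \<open>r^-q\<close> is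
  \<open>1 / Gamma q\<close> times the integral of \<open>t^(q - 1) exp (- t r)\<close> over
  \<open>t > 0\<close>. For \<open>r = 1 + |x|^2\<close>, integrating over \<open>x\<close> first is
  Gaussian and lowers the exponent of \<open>t\<close> by \<open>n / 2\<close>, which leaves the
  integral of \<open>Gamma b\<close>.\<close>

lemma nn_integral_one_plus_inner_powr:
  fixes b :: real
  assumes b: "b > 0"
  shows "(\<integral>\<^sup>+x. ennreal ((1 + x \<bullet> x) powr (- (b + real CARD('n) / 2))) \<partial>(lborel :: (real ^ 'n) measure))
    = ennreal (pi powr (real CARD('n) / 2) * Gamma b / Gamma (b + real CARD('n) / 2))"
proof -
  define q where "q = b + real CARD('n) / 2"
  have q: "q > 0" using b by (simp add: q_def add_pos_nonneg)
  have Gq: "Gamma q > 0" and Gb: "Gamma b > 0" using q b by (simp_all add: Gamma_real_pos)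
  define h where "h t r = ennreal (indicator {0..} t * t powr (q - 1) * exp (- (t * r)))" for t r :: real
  have h_meas[measurable]: "case_prod h \<in> borel_measurable (borel \<Otimes>\<^sub>M borel)"
    unfolding h_def by measurable
  have scaled: "(\<integral>\<^sup>+t. h t r \<partial>lborel) = ennreal (Gamma q * r powr (- q))" if r: "r > 0" for r
  proof -
    have "ennreal (Gamma q) = (\<integral>\<^sup>+t. ennreal (indicator {0..} t * t powr (q - 1) / exp t) \<partial>lborel)"
      using Gamma_conv_nn_integral_real[OF q] by simp
    also have "\<dots> = ennreal \<bar>r\<bar> * (\<integral>\<^sup>+t. ennreal (indicator {0..} (0 + r * t) * (0 + r * t) powr (q - 1) / exp (0 + r * t)) \<partial>lborel)"
      using r by (intro nn_integral_real_affine) auto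
    also have "\<dots> = ennreal r * (\<integral>\<^sup>+t. ennreal (r powr (q - 1)) * h t r \<partial>lborel)"
    proof -
      have "ennreal (indicator {0..} (0 + r * t) * (0 + r * t) powr (q - 1) / exp (0 + r * t))
        = ennreal (r powr (q - 1)) * h t r" for t
        unfolding h_def using r
        by (subst ennreal_mult[symmetric])
           (auto simp: powr_mult exp_minus field_simps indicator_def zero_le_mult_iff)
      then show ?thesis using r by simp
    qed
    also have "\<dots> = ennreal (r powr q) * (\<integral>\<^sup>+t. h t r \<partial>lborel)"
    proof -
      have "ennreal r * ennreal (r powr (q - 1)) = ennreal (r powr q)"
        using r by (simp add: ennreal_mult[symmetric] powr_diff)
      then show ?thesis by (simp add: nn_integral_cmult mult.assoc[symmetric])
    qed
    finally have "ennreal (r powr (- q)) * ennreal (Gamma q)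
      = ennreal (r powr (- q)) * (ennreal (r powr q) * (\<integral>\<^sup>+t. h t r \<partial>lborel))" by simp
    also have "\<dots> = (\<integral>\<^sup>+t. h t r \<partial>lborel)"
      using r by (simp add: mult.assoc[symmetric] ennreal_mult[symmetric] powr_minus)
    finally show ?thesis using Gq by (simp add: ennreal_mult mult.commute)
  qed
  have gauss: "(\<integral>\<^sup>+x. h t (1 + x \<bullet> x) \<partial>(lborel :: (real ^ 'n) measure))
      = ennreal (pi powr (real CARD('n) / 2)) * ennreal (indicator {0..} t * t powr (b - 1) / exp t)" for t
  proof (cases "t > 0")
    case True
    have "(\<integral>\<^sup>+x. h t (1 + x \<bullet> x) \<partial>(lborel :: (real ^ 'n) measure))
      = (\<integral>\<^sup>+x. ennreal (t powr (q - 1) * exp (- t)) * ennreal (exp (- (t * (x \<bullet> x)))) \<partial>(lborel :: (real ^ 'n) measure))"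
      using True by (intro nn_integral_cong)
        (simp add: h_def ennreal_mult[symmetric] distrib_left exp_add[symmetric] mult.assoc)
    also have "\<dots> = ennreal (t powr (q - 1) * exp (- t)) * ennreal ((pi / t) powr (real CARD('n) / 2))"
      by (simp add: nn_integral_cmult nn_integral_exp_neg_inner[OF True])
    also have "\<dots> = ennreal (pi powr (real CARD('n) / 2)) * ennreal (indicator {0..} t * t powr (b - 1) / exp t)"
    proof -
      have "t powr (q - 1) = t powr (b - 1) * t powr (real CARD('n) / 2)"
        by (simp add: q_def powr_add[symmetric] algebra_simps)
      then show ?thesis
        using True by (simp add: ennreal_mult[symmetric] powr_divide exp_minus field_simps)
    qed
    finally show ?thesis .
  next
    case False
    \<comment> \<open>At \<open>t = 0\<close> both sides vanish because \<open>0 powr y = 0\<close>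
      for every \<open>y\<close>; for negative \<open>t\<close> the indicator is zero.\<close>
    then show ?thesis by (cases "t = 0") (auto simp: h_def)
  qed
  have "ennreal (Gamma q) * (\<integral>\<^sup>+x. ennreal ((1 + x \<bullet> x) powr (- q)) \<partial>(lborel :: (real ^ 'n) measure))
    = (\<integral>\<^sup>+x. \<integral>\<^sup>+t. h t (1 + x \<bullet> x) \<partial>lborel \<partial>(lborel :: (real ^ 'n) measure))"
    using Gq by (subst scaled) (auto simp: ennreal_mult nn_integral_cmult add_pos_nonneg)
  also have "\<dots> = (\<integral>\<^sup>+t. \<integral>\<^sup>+x. h t (1 + x \<bullet> x) \<partial>(lborel :: (real ^ 'n) measure) \<partial>lborel)"
    by (rule lborel_pair.Fubini'[symmetric]) measurable
  also have "\<dots> = ennreal (pi powr (real CARD('n) / 2)) * ennreal (Gamma b)"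
    unfolding gauss using Gamma_conv_nn_integral_real[OF b] by (subst nn_integral_cmult) auto
  finally have "ennreal (1 / Gamma q) * (ennreal (Gamma q) * (\<integral>\<^sup>+x. ennreal ((1 + x \<bullet> x) powr (- q)) \<partial>(lborel :: (real ^ 'n) measure)))
    = ennreal (1 / Gamma q) * (ennreal (pi powr (real CARD('n) / 2)) * ennreal (Gamma b))" by simp
  then show ?thesis
    using Gq Gb by (simp add: mult.assoc[symmetric] ennreal_mult[symmetric] q_def)
qed

text \<open>Integrating the Gaussian \<open>exp (- |R x|\<^sup>2)\<close> over \<open>x\<close> produces the factor \<open>1 / |det R|\<close>,
  which relates the exponents \<open>a\<close> and \<open>a + 1\<close>.\<close>

lemma row_integral_id_step:
  assumes a: "a > - 1"
  shows "row_integral a (mat 1 :: real ^ 'n ^ 'n)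
    = ennreal (Gamma ((a + 1) / 2) / Gamma ((a + 1 + real CARD('n)) / 2))
      * row_integral (a + 1) (mat 1 :: real ^ 'n ^ 'n)"
proof -
  let ?I = "mat 1 :: real ^ 'n ^ 'n"
  interpret rows: sigma_finite_measure "lborel_rows :: ('n \<Rightarrow> real ^ 'n) measure"
    by (rule sigma_finite_lborel_rows)
  interpret pair_sigma_finite "lborel_rows :: ('n \<Rightarrow> real ^ 'n) measure" "lborel :: (real ^ 'n) measure" ..
  have inner: "(\<integral>\<^sup>+x. ennreal (row_weight (a + 1) (?I + outer x) f) \<partial>lborel)
      = ennreal (pi powr (real CARD('n) / 2)) * ennreal (row_weight a ?I f)" for f :: "'n \<Rightarrow> real ^ 'n"
  proof (cases "det (\<chi> i. f i) = 0")
    \<comment> \<open>Both weights vanish here, the one with exponent \<open>a\<close> because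
      \<open>0 powr a = 0\<close> also for negative \<open>a\<close>.\<close>
    case True
    then show ?thesis by (simp add: row_weight_def)
  next
    case False
    define R where "R = (\<chi> i. f i)"
    have R: "det R \<noteq> 0" "\<And>i. f i = R $ i" using False by (simp_all add: R_def)
    have "row_weight (a + 1) (?I + outer x) f
      = row_weight (a + 1) ?I f * exp (- (x \<bullet> ((transpose R ** R) *v x)))" for x
      unfolding inner_gram_mult_vector
      by (simp add: row_weight_def R(2) matrix_vector_mult_add_rdistrib inner_add_right sum.distrib exp_add
          exp_diff exp_minus field_simps)
    then have "(\<integral>\<^sup>+x. ennreal (row_weight (a + 1) (?I + outer x) f) \<partial>lborel)
      = ennreal (row_weight (a + 1) ?I f) * ennreal (pi powr (real CARD('n) / 2) / sqrt (det (transpose R ** R)))"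
      by (simp add: ennreal_mult row_weight_nonneg nn_integral_cmult
          nn_integral_exp_neg_quadratic[OF posdef_cone_gram[OF R(1)]])
    also have "sqrt (det (transpose R ** R)) = \<bar>det R\<bar>" by (simp add: det_mul)
    also have "ennreal (row_weight (a + 1) ?I f) * ennreal (pi powr (real CARD('n) / 2) / \<bar>det R\<bar>)
      = ennreal (pi powr (real CARD('n) / 2)) * ennreal (row_weight a ?I f)"
      using R(1) by (simp add: ennreal_mult[symmetric] row_weight_nonneg)
         (simp add: row_weight_def R_def[symmetric] powr_add field_simps)
    finally show ?thesis .
  qed
  have meas: "(\<lambda>(f, x). ennreal (row_weight (a + 1) (?I + outer x) f)) \<in> borel_measurable (lborel_rows \<Otimes>\<^sub>M lborel)"
    unfolding row_weight_def outer_def by measurable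
  have "ennreal (pi powr (real CARD('n) / 2)) * row_integral a ?I
      = (\<integral>\<^sup>+f. \<integral>\<^sup>+x. ennreal (row_weight (a + 1) (?I + outer x) f) \<partial>lborel \<partial>lborel_rows)"
    by (simp add: inner nn_integral_cmult row_integral_def)
  also have "\<dots> = (\<integral>\<^sup>+x. \<integral>\<^sup>+f. ennreal (row_weight (a + 1) (?I + outer x) f) \<partial>lborel_rows \<partial>lborel)"
    using meas by (rule Fubini'[symmetric])
  also have "\<dots> = (\<integral>\<^sup>+x. row_integral (a + 1) (?I + outer x) \<partial>lborel)"
    by (simp add: row_integral_def)
  \<comment> \<open>\<open>row_integral_eq\<close> at \<open>1 + x x^T\<close>, whose determinant is
    \<open>1 + |x|^2\<close>. The exponent has the form \<open>b + n / 2\<close> with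
    \<open>b = (a + 1) / 2\<close>, which is positive because \<open>a > - 1\<close>.\<close>
  also have "\<dots> = (\<integral>\<^sup>+x. ennreal ((1 + x \<bullet> x) powr (- ((a + 1) / 2 + real CARD('n) / 2))) * row_integral (a + 1) ?I
      \<partial>(lborel :: (real ^ 'n) measure))"
  proof (rule nn_integral_cong)
    fix x :: "real ^ 'n"
    show "row_integral (a + 1) (?I + outer x)
      = ennreal ((1 + x \<bullet> x) powr (- ((a + 1) / 2 + real CARD('n) / 2))) * row_integral (a + 1) ?I"
      by (subst row_integral_eq[OF posdef_cone_add_outer[OF posdef_cone_id]])
         (simp add: det_id_add_outer add_divide_distrib diff_divide_distrib)
  qed
  also have "\<dots> = ennreal (pi powr (real CARD('n) / 2) * Gamma ((a + 1) / 2) / Gamma ((a + 1) / 2 + real CARD('n) / 2))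
      * row_integral (a + 1) ?I"
    using a nn_integral_one_plus_inner_powr[of "(a + 1) / 2", where 'n = 'n]
    by (subst nn_integral_multc) auto
  finally have "ennreal (1 / pi powr (real CARD('n) / 2)) * (ennreal (pi powr (real CARD('n) / 2)) * row_integral a ?I)
    = ennreal (1 / pi powr (real CARD('n) / 2)) *
      (ennreal (pi powr (real CARD('n) / 2) * Gamma ((a + 1) / 2) / Gamma ((a + 1) / 2 + real CARD('n) / 2))
      * row_integral (a + 1) ?I)" by simp
  then show ?thesis
    using a by (simp add: mult.assoc[symmetric] ennreal_mult[symmetric] add_divide_distrib Gamma_real_nonneg)
qed

text \<open>For \<open>x > 1\<close> the exponent is raised to an even integer \<open>2 * m\<close>,
  and \<open>(x^2 / 2)^m / m!\<close> is a single term of the series of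
  \<open>exp (x^2 / 2)\<close>. For \<open>x\<close> up to 1 the power is at most 1.\<close>

lemma powr_le_exp_square:
  fixes c :: real
  assumes c: "c \<ge> 0"
  obtains K :: real where "K > 0" "\<And>x. (x::real) \<ge> 0 \<Longrightarrow> x powr c \<le> K * exp (x\<^sup>2 / 2)"
proof -
  define m where "m = nat \<lceil>c\<rceil>"
  have m: "c \<le> real m" using c by (simp add: m_def)
  define K :: real where "K = 1 + 2 ^ m * fact m"
  have "x powr c \<le> K * exp (x\<^sup>2 / 2)" if x: "x \<ge> 0" for x
  proof (cases "x \<le> 1")
    case True
    then have "x powr c \<le> 1" using x c by (simp add: powr_le1)
    also have "\<dots> \<le> K * exp (x\<^sup>2 / 2)"
      using mult_mono[of 1 K 1 "exp (x\<^sup>2 / 2)"] by (simp add: K_def)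
    finally show ?thesis .
  next
    case False
    then have "x powr c \<le> x powr real (2 * m)" using m by (intro powr_mono) auto
    also have "\<dots> = 2 ^ m * fact m * ((x\<^sup>2 / 2) ^ m / fact m)"
      using False powr_realpow[of x "2 * m"] by (simp add: power_mult power_divide)
    also have "\<dots> \<le> 2 ^ m * fact m * exp (x\<^sup>2 / 2)"
    proof -
      have "(\<Sum>n\<in>{m}. (x\<^sup>2 / 2) ^ n /\<^sub>R fact n) \<le> (\<Sum>n. (x\<^sup>2 / 2) ^ n /\<^sub>R fact n)"
        by (rule sum_le_suminf[OF summable_exp_generic]) auto
      then have "(x\<^sup>2 / 2) ^ m / fact m \<le> exp (x\<^sup>2 / 2)"
        unfolding exp_def by (simp only: sum.insert sum.empty finite.emptyI empty_iff if_False
            real_scaleR_def divide_inverse_commute[of _ "fact m"] add_0_right not_False_eq_True)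
      then show ?thesis by (rule mult_left_mono) simp
    qed
    also have "\<dots> \<le> K * exp (x\<^sup>2 / 2)" by (simp add: K_def)
    finally show ?thesis .
  qed
  moreover have "K > 0" by (simp add: K_def add_pos_nonneg)
  ultimately show thesis using that by blast
qed

text \<open>A crude bound: the Leibniz formula has \<open>n!\<close> terms, each a product of
  \<open>n\<close> entries bounded by the norm.\<close>

lemma abs_det_le_norm_power:
  fixes R :: "real ^ 'n ^ 'n"
  shows "\<bar>det R\<bar> \<le> fact CARD('n) * norm R ^ CARD('n)"
proof -
  have "\<bar>det R\<bar> \<le> (\<Sum>p | p permutes (UNIV :: 'n set). \<bar>of_int (sign p) * (\<Prod>i\<in>UNIV. R $ i $ p i)\<bar>)"
    unfolding det_def by (rule sum_abs)
  also have "\<dots> \<le> (\<Sum>p | p permutes (UNIV :: 'n set). norm R ^ CARD('n))"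
  proof (rule sum_mono)
    fix p :: "'n \<Rightarrow> 'n"
    have "\<bar>of_int (sign p) * (\<Prod>i\<in>UNIV. R $ i $ p i)\<bar> = (\<Prod>i\<in>UNIV. \<bar>R $ i $ p i\<bar>)"
      by (simp add: abs_mult abs_prod sign_def)
    also have "\<dots> \<le> (\<Prod>i\<in>(UNIV :: 'n set). norm R)"
    proof (rule prod_mono)
      fix i
      have "\<bar>R $ i $ p i\<bar> \<le> norm (R $ i)" by (rule component_le_norm_cart)
      also have "\<dots> \<le> norm R" by (rule Finite_Cartesian_Product.norm_nth_le)
      finally show "0 \<le> \<bar>R $ i $ p i\<bar> \<and> \<bar>R $ i $ p i\<bar> \<le> norm R" by simp
    qed
    finally show "\<bar>of_int (sign p) * (\<Prod>i\<in>UNIV. R $ i $ p i)\<bar> \<le> norm R ^ CARD('n)" by simp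
  qed
  also have "\<dots> = fact CARD('n) * norm R ^ CARD('n)"
    by (simp add: card_permutations[of "UNIV :: 'n set", OF refl])
  finally show ?thesis .
qed

text \<open>Half of the Gaussian exponent absorbs the growth of \<open>|det R|^a\<close>, which is
  at most a constant times \<open>norm R\<close> to the power \<open>n * a\<close>. The other half
  factors over the rows into convergent integrals.\<close>

lemma row_integral_id_finite_nonneg:
  assumes a: "a \<ge> 0"
  shows "row_integral a (mat 1 :: real ^ 'n ^ 'n) < \<infinity>"
proof -
  interpret product_sigma_finite "\<lambda>_::'n. lborel :: (real ^ 'n) measure"
    by (rule product_sigma_finite_lborel)
  obtain K where K: "K > 0" "\<And>x. x \<ge> 0 \<Longrightarrow> x powr (real CARD('n) * a) \<le> K * exp (x\<^sup>2 / 2)"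
    using powr_le_exp_square[of "real CARD('n) * a"] a by auto
  define L where "L = fact CARD('n) powr a * K"
  have L: "L \<ge> 0" using K(1) by (simp add: L_def)
  have bound: "row_weight a (mat 1) f \<le> L * (\<Prod>i\<in>UNIV. exp (- (1 / 2 * (f i \<bullet> f i))))" for f :: "'n \<Rightarrow> real ^ 'n"
  proof -
    let ?R = "\<chi> i. f i"
    have norm2: "(norm ?R)\<^sup>2 = (\<Sum>i\<in>UNIV. f i \<bullet> f i)"
      by (simp add: power2_norm_eq_inner inner_vec_def)
    have "\<bar>det ?R\<bar> powr a \<le> (fact CARD('n) * norm ?R ^ CARD('n)) powr a"
      using a abs_det_le_norm_power[of ?R] by (intro powr_mono2) auto
    also have "\<dots> = fact CARD('n) powr a * norm ?R powr (real CARD('n) * a)"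
      by (cases "?R = 0") (simp_all add: powr_mult powr_powr[symmetric] powr_realpow)
    also have "\<dots> \<le> L * exp ((norm ?R)\<^sup>2 / 2)"
      using K(2)[of "norm ?R"] by (simp add: L_def mult.assoc mult_left_mono)
    finally have "row_weight a (mat 1) f \<le> exp (- (norm ?R)\<^sup>2) * (L * exp ((norm ?R)\<^sup>2 / 2))"
      by (simp add: row_weight_def norm2 mult_left_mono)
    also have "\<dots> = L * exp (- ((norm ?R)\<^sup>2 / 2))"
      by (simp add: exp_add[symmetric] mult.left_commute)
    also have "exp (- ((norm ?R)\<^sup>2 / 2)) = (\<Prod>i\<in>UNIV. exp (- (1 / 2 * (f i \<bullet> f i))))"
      by (simp add: norm2 exp_sum[symmetric] sum_negf sum_divide_distrib)
    finally show ?thesis .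
  qed
  have "row_integral a (mat 1 :: real ^ 'n ^ 'n)
      \<le> (\<integral>\<^sup>+f. ennreal L * (\<Prod>i\<in>UNIV. ennreal (exp (- (1 / 2 * (f i \<bullet> f i))))) \<partial>(lborel_rows :: ('n \<Rightarrow> real ^ 'n) measure))"
    unfolding row_integral_def
    by (intro nn_integral_mono)
       (simp only: prod_ennreal exp_ge_zero ennreal_mult[symmetric] L prod_nonneg bound ennreal_leI)
  also have "\<dots> = ennreal L * (\<Prod>i\<in>(UNIV :: 'n set). \<integral>\<^sup>+x. ennreal (exp (- (1 / 2 * (x \<bullet> x)))) \<partial>(lborel :: (real ^ 'n) measure))"
    by (subst nn_integral_cmult, measurable)
       (subst product_nn_integral_prod[where f = "\<lambda>_ x. ennreal (exp (- (1 / 2 * (x \<bullet> x))))"], auto)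
  also have "\<dots> < \<infinity>"
    by (simp add: nn_integral_exp_neg_inner[of "1 / 2", simplified] ennreal_mult_less_top ennreal_power)
  finally show ?thesis .
qed

text \<open>For negative \<open>a\<close> the weight is unbounded near singular matrices, so no
  direct domination works. The recursion transfers finiteness from the exponent
  \<open>a + 1 > 0\<close>.\<close>

lemma row_integral_id_finite:
  assumes a: "a > - 1"
  shows "row_integral a (mat 1 :: real ^ 'n ^ 'n) < \<infinity>"
  using row_integral_id_finite_nonneg[of "a + 1", where 'n = 'n] a
  by (subst row_integral_id_step[OF a]) (simp add: ennreal_mult_less_top)

text \<open>The weight vanishes only at singular matrices. The nonsingular ones form an open set
  around the identity, which contains a product of nonempty open sets and so has positive
  measure.\<close>

lemma row_integral_id_pos:
  "row_integral a (mat 1 :: real ^ 'n ^ 'n) > 0"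
proof -
  let ?S = "{f :: 'n \<Rightarrow> real ^ 'n. det (\<chi> i. f i) \<noteq> 0}"
  interpret product_sigma_finite "\<lambda>_::'n. lborel :: (real ^ 'n) measure"
    by (rule product_sigma_finite_lborel)
  have S_sets: "?S \<in> sets lborel_rows"
  proof -
    have "{f \<in> space (lborel_rows :: ('n \<Rightarrow> real ^ 'n) measure). det (\<chi> i. f i) \<noteq> 0} \<in> sets lborel_rows" by measurable
    then show ?thesis by (simp add: space_PiM)
  qed
  have "continuous_on UNIV (\<lambda>f :: 'n \<Rightarrow> real ^ 'n. det (\<chi> i. f i))"
    unfolding det_def by (auto intro!: continuous_intros)
  then have "open ?S"
    using open_Collect_neq[of "\<lambda>f :: 'n \<Rightarrow> real ^ 'n. det (\<chi> i. f i)" "\<lambda>_. 0"] by simp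
  then have "openin (product_topology (\<lambda>_. euclidean) UNIV) ?S" by (simp add: open_fun_def)
  moreover have "(\<lambda>i. axis i 1) \<in> ?S"
  proof -
    have "(\<chi> i. axis i 1) = (mat 1 :: real ^ 'n ^ 'n)" by (simp add: vec_eq_iff mat_def axis_def eq_commute)
    then show ?thesis by simp
  qed
  ultimately obtain X where X: "(\<lambda>i. axis i 1) \<in> (\<Pi>\<^sub>E i\<in>UNIV. X i)"
      "\<And>i. openin euclidean (X i)" "(\<Pi>\<^sub>E i\<in>UNIV. X i) \<subseteq> ?S"
    using product_topology_open_contains_basis[of "\<lambda>_. euclidean" UNIV ?S "\<lambda>i. axis i 1"] by auto
  have Xo: "open (X i)" for i by (metis X(2) open_openin)
  have "emeasure lborel (X i) \<noteq> 0" for i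
  proof
    assume "emeasure lborel (X i) = 0"
    then have "X i \<in> null_sets lborel" using Xo[of i] by auto
    then have "negligible (X i)" by (simp add: negligible_iff_null_sets null_sets_completionI)
    moreover have "X i \<noteq> {}" using X(1) by auto
    ultimately show False using open_not_negligible[OF Xo[of i]] by simp
  qed
  then have "emeasure lborel_rows (\<Pi>\<^sub>E i\<in>UNIV. X i) \<noteq> 0"
    using Xo by (subst emeasure_PiM) auto
  moreover have "emeasure lborel_rows (\<Pi>\<^sub>E i\<in>UNIV. X i) \<le> emeasure lborel_rows ?S"
    using X(3) S_sets by (rule emeasure_mono)
  moreover have "emeasure lborel_rows ?S = 0" if "row_integral a (mat 1 :: real ^ 'n ^ 'n) = 0"
  proof -
    have "AE f in lborel_rows. ennreal (row_weight a (mat 1 :: real ^ 'n ^ 'n) f) = 0"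
      using that by (simp add: row_integral_def nn_integral_0_iff_AE)
    then have "AE f in lborel_rows. f \<notin> ?S"
      by eventually_elim (auto simp: row_weight_def ennreal_eq_0_iff mult_le_0_iff)
    then show ?thesis using S_sets by (subst (asm) AE_iff_measurable[of ?S]) (auto simp: space_PiM)
  qed
  ultimately show ?thesis by (auto simp: zero_less_iff_neq_zero)
qed

section \<open>Injectivity of the Laplace transform\<close>

text \<open>The indicator of a closed set \<open>C\<close> is the pointwise limit of the continuous
  functions \<open>max 0 (1 - k * infdist x C)\<close>, so the measures agree on closed sets. These
  are stable under intersection and generate the Borel sets.\<close>

lemma finite_measure_eqI_continuous:
  fixes M N :: "'a::metric_space measure"
  assumes "finite_measure M" "finite_measure N"
    and sets: "sets M = sets borel" "sets N = sets borel"
    and eq: "\<And>f :: 'a \<Rightarrow> real. continuous_on UNIV f \<Longrightarrow> (\<And>x. 0 \<le> f x \<and> f x \<le> 1) \<Longrightarrow>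
      (\<integral>x. f x \<partial>M) = (\<integral>x. f x \<partial>N)"
  shows "M = N"
proof -
  interpret M: finite_measure M by fact
  interpret N: finite_measure N by fact
  have space: "space M = UNIV" "space N = UNIV" using sets by (metis sets_eq_imp_space_eq space_borel)+
  have closed: "emeasure M C = emeasure N C" if C: "closed C" for C
  \<comment> \<open>The empty set needs its own case because \<open>infdist x {}\<close> is 0 by
    convention.\<close>
  proof (cases "C = {}")
    case False
    define f where "f k x = max 0 (1 - real k * infdist x C)" for k x
    have f_cont: "continuous_on UNIV (f k)" for k
      unfolding f_def[abs_def] by (intro continuous_intros)
    have f_range: "0 \<le> f k x \<and> f k x \<le> 1" for k x
      by (simp add: f_def infdist_nonneg)
    have lim: "(\<lambda>k. f k x) \<longlonglongrightarrow> indicator C x" for x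
    proof (cases "x \<in> C")
      case True
      then show ?thesis by (simp add: f_def)
    next
      case nC: False
      then have "infdist x C > 0"
        using C False infdist_nonneg[of x C] by (metis in_closed_iff_infdist_zero less_eq_real_def)
      then obtain K where K: "1 < real K * infdist x C" using reals_Archimedean3 by blast
      have "f k x = 0" if "k \<ge> K" for k
      proof -
        have "real K * infdist x C \<le> real k * infdist x C"
          using that infdist_nonneg[of x C] by (intro mult_right_mono) auto
        then show ?thesis using K by (simp add: f_def)
      qed
      then have "eventually (\<lambda>k. f k x = indicator C x) sequentially"
        using nC by (auto simp: eventually_sequentially)
      then show ?thesis by (rule tendsto_eventually)
    qed
    have lim_int: "(\<lambda>k. \<integral>x. f k x \<partial>L) \<longlonglongrightarrow> (\<integral>x. indicator C x \<partial>L)"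
      if "finite_measure L" "sets L = sets borel" for L
    proof (rule integral_dominated_convergence[where w = "\<lambda>_. 1"])
      interpret finite_measure L by fact
      show "indicator C \<in> borel_measurable L"
        using C by (intro borel_measurable_indicator) (simp add: that)
      show "integrable L (\<lambda>_. 1)" by simp
      show "f k \<in> borel_measurable L" for k
        using borel_measurable_continuous_onI[OF f_cont] that by (simp cong: measurable_cong_sets)
    qed (use lim f_range in auto)
    have "(\<integral>x. indicator C x \<partial>M) = (\<integral>x. indicator C x \<partial>N :: real)"
      using lim_int[OF assms(1) sets(1)] lim_int[OF assms(2) sets(2)]
        eq[OF f_cont f_range] by (simp add: LIMSEQ_unique)
    then have "measure M C = measure N C" using C sets by (simp add: space)
    then show ?thesis by (simp add: M.emeasure_eq_measure N.emeasure_eq_measure)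
  qed simp
  show ?thesis
  proof (rule measure_eqI_generator_eq[where \<Omega> = UNIV and E = "Collect closed" and A = "\<lambda>_. UNIV"])
    show "Int_stable (Collect closed :: 'a set set)" by (auto simp: Int_stable_def)
    show "sets M = sigma_sets UNIV (Collect closed)" "sets N = sigma_sets UNIV (Collect closed)"
      by (simp_all add: sets borel_eq_closed)
    show "emeasure M UNIV \<noteq> \<infinity>" using M.emeasure_finite[of UNIV] by simp
  qed (use closed in auto)
qed

text \<open>The linear span of the exponentials tested by the Laplace transform. Allowing
  \<open>s = 0\<close> adds the constants, so that the span is a unital algebra.\<close>

inductive exp_sum :: "(real ^ 'n ^ 'n \<Rightarrow> real) \<Rightarrow> bool" where
  exp_sum_exp: "s \<in> posdef_cone \<or> s = 0 \<Longrightarrow> exp_sum (\<lambda>u. c * exp (- trace (s ** u)))"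
| exp_sum_add: "exp_sum f \<Longrightarrow> exp_sum g \<Longrightarrow> exp_sum (\<lambda>u. f u + g u)"

lemma trace_zero: "trace (0 :: real ^ 'n ^ 'n) = 0"
  by (simp add: trace_def)

lemma exp_sum_const: "exp_sum (\<lambda>u :: real ^ 'n ^ 'n. c)"
  using exp_sum_exp[of "0 :: real ^ 'n ^ 'n" c] by (simp add: trace_zero)

lemma trace_add_mult: "trace ((s + t) ** u) = trace (s ** u) + trace (t ** (u :: real ^ 'n ^ 'n))"
  by (simp add: matrix_add_mult_distrib trace_add)

text \<open>Multiplying two exponentials adds their matrices, and the cone together with 0 is closed
  under addition.\<close>

lemma exp_sum_mult:
  assumes "exp_sum f" "exp_sum g"
  shows "exp_sum (\<lambda>u. f u * g u)"
  using assms
proof (induction rule: exp_sum.induct)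
  case (exp_sum_exp s c)
  from exp_sum_exp(2) exp_sum_exp(1) show ?case
  proof (induction rule: exp_sum.induct)
    case (exp_sum_exp t d)
    then have "s + t \<in> posdef_cone \<or> s + t = 0" using posdef_cone_add by auto
    from exp_sum.exp_sum_exp[OF this, of "c * d"] show ?case
      by (simp add: trace_add_mult exp_add[symmetric] mult_ac exp_diff exp_minus field_simps)
  next
    case (exp_sum_add f g)
    then show ?case by (simp add: distrib_left exp_sum.exp_sum_add)
  qed
next
  case (exp_sum_add f g)
  then show ?case by (simp add: distrib_right exp_sum.exp_sum_add)
qed

lemma exp_sum_sum:
  assumes "finite I" "\<And>i. i \<in> I \<Longrightarrow> exp_sum (f i)"
  shows "exp_sum (\<lambda>u. \<Sum>i\<in>I. f i u)"
  using assms by (induction I rule: finite_induct) (auto intro: exp_sum_const exp_sum_add)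

text \<open>Any family of positive definite matrices spanning the symmetric ones would do here.\<close>

definition laplace_probe :: "'n \<Rightarrow> 'n \<Rightarrow> real ^ 'n ^ 'n" where
  "laplace_probe i j = mat 1 + outer (axis i 1 + axis j 1)"

lemma laplace_probe_posdef_cone: "laplace_probe i j \<in> posdef_cone"
  unfolding laplace_probe_def by (intro posdef_cone_add_outer posdef_cone_id)

lemma trace_laplace_probe_mult:
  fixes u :: "real ^ 'n ^ 'n"
  shows "trace (laplace_probe i j ** u) = trace u + (u $ i $ i + u $ i $ j + u $ j $ i + u $ j $ j)"
proof -
  have "axis k 1 \<bullet> (u *v axis l 1) = u $ k $ l" for k l
    by (simp add: inner_axis' matrix_vector_mult_basis column_def)
  then show ?thesis
    by (simp add: laplace_probe_def trace_add_mult trace_outer_mult matrix_vector_right_distrib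
        inner_add_left inner_add_right)
qed

text \<open>The embedding of the cone into a bounded set. Each entry is itself a tested exponential,
  so polynomials in the entries stay in \<open>exp_sum\<close>.\<close>

definition laplace_coords :: "real ^ 'n ^ 'n \<Rightarrow> real ^ 'n ^ 'n" where
  "laplace_coords u = (\<chi> i j. exp (- trace (laplace_probe i j ** u)))"

text \<open>A linear functional is a combination of matrix entries, each of which is one exponential
  here; sums and products stay inside the algebra.\<close>

lemma exp_sum_polynomial:
  fixes q :: "real ^ 'n ^ 'n \<Rightarrow> real"
  assumes "real_polynomial_function q"
  shows "exp_sum (\<lambda>u. q (laplace_coords u))"
  using assms
proof (induction rule: real_polynomial_function.induct)
  case (linear f)
  have rep: "f y = (\<Sum>i\<in>UNIV. \<Sum>j\<in>UNIV. f (axis i (axis j 1)) * y $ i $ j)" for y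
  proof -
    have "y = (\<Sum>i\<in>UNIV. \<Sum>j\<in>UNIV. (y $ i $ j) *\<^sub>R axis i (axis j 1))"
    proof (subst vec_eq_iff, intro allI, subst vec_eq_iff, intro allI)
      fix a b
      have "(\<Sum>i\<in>UNIV. \<Sum>j\<in>UNIV. (y $ i $ j) *\<^sub>R axis i (axis j 1)) $ a $ b
        = (\<Sum>i\<in>UNIV. \<Sum>j\<in>UNIV. if i = a then (if j = b then y $ i $ j else 0) else 0)"
        by (auto simp: axis_def intro!: sum.cong)
      also have "\<dots> = (\<Sum>i\<in>UNIV. if i = a then y $ i $ b else 0)"
        by (intro sum.cong) auto
      finally show "y $ a $ b = (\<Sum>i\<in>UNIV. \<Sum>j\<in>UNIV. (y $ i $ j) *\<^sub>R axis i (axis j 1)) $ a $ b"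
        by simp
    qed
    then have "f y = f (\<Sum>i\<in>UNIV. \<Sum>j\<in>UNIV. (y $ i $ j) *\<^sub>R axis i (axis j 1))" by simp
    also have "\<dots> = (\<Sum>i\<in>UNIV. \<Sum>j\<in>UNIV. f (axis i (axis j 1)) * y $ i $ j)"
      using linear by (simp add: bounded_linear.linear linear_sum linear_scale mult.commute)
    finally show ?thesis .
  qed
  have "(\<lambda>u. f (laplace_coords u)) = (\<lambda>u. \<Sum>i\<in>UNIV. \<Sum>j\<in>UNIV. f (axis i (axis j 1)) * exp (- trace (laplace_probe i j ** u)))"
    by (rule ext, subst rep) (simp add: laplace_coords_def)
  then show ?case
    by (simp only:) (intro exp_sum_sum exp_sum_exp, auto simp: laplace_probe_posdef_cone)
qed (auto intro: exp_sum_const exp_sum_add exp_sum_mult)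

text \<open>For symmetric \<open>u\<close> the logarithms are
  \<open>z i j = tr u + u_ii + 2 u_ij + u_jj\<close>. On the diagonal
  \<open>z i i = tr u + 4 u_ii\<close>, and summing gives \<open>(n + 4) tr u\<close>. Hence
  \<open>t\<close> recovers the trace, \<open>d i\<close> the diagonal entry and the final
  expression \<open>u_ij\<close>.\<close>

definition laplace_coords_inv :: "real ^ 'n ^ 'n \<Rightarrow> real ^ 'n ^ 'n" where
  "laplace_coords_inv y = (let z = (\<lambda>i j. - ln (y $ i $ j));
      t = (\<Sum>i\<in>UNIV. z i i) / (real CARD('n) + 4);
      d = (\<lambda>i. (z i i - t) / 4)
    in \<chi> i j. (z i j - t - d i - d j) / 2)"

lemma laplace_coords_inv:
  fixes u :: "real ^ 'n ^ 'n"
  assumes "transpose u = u"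
  shows "laplace_coords_inv (laplace_coords u) = u"
proof -
  have sym: "u $ j $ i = u $ i $ j" for i j
    using assms by (metis transpose_def vec_lambda_beta)
  have z: "- ln (laplace_coords u $ i $ j) = trace u + (u $ i $ i + 2 * u $ i $ j + u $ j $ j)" for i j
    by (simp add: laplace_coords_def trace_laplace_probe_mult sym)
  have "(\<Sum>i\<in>UNIV. trace u + (u $ i $ i + 2 * u $ i $ i + u $ i $ i)) = (\<Sum>i\<in>UNIV. trace u + 4 * u $ i $ i)"
    by simp
  also have "\<dots> = (real CARD('n) + 4) * trace u"
    by (simp add: sum.distrib sum_distrib_left[symmetric] trace_def algebra_simps)
  finally have t: "(\<Sum>i\<in>UNIV. trace u + (u $ i $ i + 2 * u $ i $ i + u $ i $ i)) / (real CARD('n) + 4) = trace u"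
    by (simp add: field_simps add_eq_0_iff)
  show ?thesis
    unfolding laplace_coords_inv_def Let_def z t by (simp add: vec_eq_iff field_simps)
qed

lemma posdef_cone_measurable:
  assumes "sets M = sets posdef_borel" "f \<in> borel_measurable borel"
  shows "f \<in> borel_measurable M"
  using measurable_restrict_space1[OF assms(2)] assms(1) by (simp cong: measurable_cong_sets)

text \<open>Every entry lies between 0 and 1 by \<open>trace_mult_posdef_cone_nonneg\<close>. The
  bound supplies the compact ball for the Stone-Weierstrass approximation.\<close>

lemma norm_laplace_coords_le:
  fixes u :: "real ^ 'n ^ 'n"
  assumes u: "u \<in> posdef_cone"
  shows "norm (laplace_coords u) \<le> real (CARD('n) * CARD('n))"
proof -
  have "norm (laplace_coords u) \<le> (\<Sum>i\<in>UNIV. norm (laplace_coords u $ i))"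
    unfolding norm_vec_def by (rule L2_set_le_sum) simp
  also have "\<dots> \<le> (\<Sum>i\<in>(UNIV :: 'n set). \<Sum>j\<in>(UNIV :: 'n set). 1)"
  proof (rule sum_mono)
    fix i
    have "norm (laplace_coords u $ i) \<le> (\<Sum>j\<in>UNIV. \<bar>laplace_coords u $ i $ j\<bar>)" by (rule norm_le_l1_cart)
    also have "\<dots> \<le> (\<Sum>j\<in>(UNIV :: 'n set). 1)"
      using trace_mult_posdef_cone_nonneg[OF laplace_probe_posdef_cone u]
      by (intro sum_mono) (simp add: laplace_coords_def)
    finally show "norm (laplace_coords u $ i) \<le> (\<Sum>j\<in>(UNIV :: 'n set). 1)" .
  qed
  finally show ?thesis by simp
qed

lemma measurable_exp_neg_trace: "(\<lambda>u :: real ^ 'n ^ 'n. exp (- trace (s ** u))) \<in> borel_measurable borel"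
  unfolding trace_def by measurable

text \<open>Both measures are pushed forward by \<open>laplace_coords\<close>. Uniform polynomial
  approximation on a ball reduces the equality of the images to equality of integrals on
  \<open>exp_sum\<close>; the measurable left inverse \<open>laplace_coords_inv\<close> then carries
  it back to the cone.\<close>

lemma laplace_transform_inj:
  fixes M N :: "(real ^ 'n ^ 'n) measure"
  assumes M: "prob_space M" "sets M = sets posdef_borel"
    and N: "prob_space N" "sets N = sets posdef_borel"
    and eq: "\<And>s. s \<in> posdef_cone \<Longrightarrow> (\<integral>u. exp (- trace (s ** u)) \<partial>M) = (\<integral>u. exp (- trace (s ** u)) \<partial>N)"
  shows "M = N"
proof -
  have space: "space L = posdef_cone" if "sets L = sets posdef_borel" for L :: "(real ^ 'n ^ 'n) measure"
    using sets_eq_imp_space_eq[OF that] by (simp add: space_restrict_space)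
  have exp_int: "integrable L (\<lambda>u. exp (- trace (s ** u)))"
    if L: "prob_space L" "sets L = sets posdef_borel" and s: "s \<in> posdef_cone \<or> s = 0"
    for L and s :: "real ^ 'n ^ 'n"
  proof -
    interpret prob_space L by fact
    show ?thesis
    proof (rule integrable_const_bound[where B = 1])
      show "AE u in L. norm (exp (- trace (s ** u))) \<le> 1"
        using s by (intro AE_I2) (auto simp: space[OF L(2)] trace_mult_posdef_cone_nonneg trace_zero)
    qed (rule posdef_cone_measurable[OF L(2) measurable_exp_neg_trace])
  qed
  have exp_sum: "integrable M f \<and> integrable N f \<and> (\<integral>u. f u \<partial>M) = (\<integral>u. f u \<partial>N)" if "exp_sum f" for f
    using that
  proof (induction rule: exp_sum.induct)
    case (exp_sum_exp s c)
    \<comment> \<open>For \<open>s = 0\<close>, which lies outside the cone, both sides are total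
      masses of probability measures.\<close>
    have "(\<integral>u. exp (- trace (s ** u)) \<partial>M) = (\<integral>u. exp (- trace (s ** u)) \<partial>N)"
      using exp_sum_exp eq M(1) N(1)
      by (auto simp: trace_zero prob_space.prob_space)
    then show ?case
      using exp_int[OF M exp_sum_exp] exp_int[OF N exp_sum_exp] by simp
  qed auto
  have coords[measurable]: "laplace_coords \<in> borel_measurable borel"
    unfolding laplace_coords_def[abs_def] trace_def by measurable
  have coordsM: "laplace_coords \<in> borel_measurable M" and coordsN: "laplace_coords \<in> borel_measurable N"
    by (rule posdef_cone_measurable[OF M(2) coords], rule posdef_cone_measurable[OF N(2) coords])
  let ?K = "cball 0 (real (CARD('n) * CARD('n))) :: (real ^ 'n ^ 'n) set"
  have close: "\<bar>(\<integral>u. g (laplace_coords u) \<partial>L) - (\<integral>u. q (laplace_coords u) \<partial>L)\<bar> \<le> e"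
    if L: "prob_space L" "sets L = sets posdef_borel" and g: "continuous_on UNIV g" "\<And>x. 0 \<le> g x \<and> g x \<le> (1::real)"
      and q: "integrable L (\<lambda>u. q (laplace_coords u))" "\<And>y. y \<in> ?K \<Longrightarrow> \<bar>g y - q y\<bar> < e" for L g q e
  proof -
    interpret prob_space L by fact
    have [measurable]: "g \<in> borel_measurable borel" by (rule borel_measurable_continuous_onI[OF g(1)])
    have g_int: "integrable L (\<lambda>u. g (laplace_coords u))"
      by (rule integrable_const_bound[where B = 1])
         (use g(2) in \<open>auto intro!: posdef_cone_measurable[OF L(2)]\<close>)
    have "\<bar>(\<integral>u. g (laplace_coords u) \<partial>L) - (\<integral>u. q (laplace_coords u) \<partial>L)\<bar>
        = \<bar>\<integral>u. g (laplace_coords u) - q (laplace_coords u) \<partial>L\<bar>"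
      using g_int q(1) by simp
    also have "\<dots> \<le> (\<integral>u. \<bar>g (laplace_coords u) - q (laplace_coords u)\<bar> \<partial>L)"
      by (rule integral_abs_bound)
    also have "\<dots> \<le> (\<integral>u. e \<partial>L)"
    proof (intro integral_mono)
      show "\<bar>g (laplace_coords u) - q (laplace_coords u)\<bar> \<le> e" if "u \<in> space L" for u
      proof -
        have "laplace_coords u \<in> ?K"
          using norm_laplace_coords_le[of u] that by (simp add: space[OF L(2)])
        from q(2)[OF this] show ?thesis by simp
      qed
    qed (use g_int q(1) in auto)
    finally show ?thesis by (simp add: prob_space)
  qed
  have "distr M borel laplace_coords = distr N borel laplace_coords"
  proof (rule finite_measure_eqI_continuous)
    show "finite_measure (distr M borel laplace_coords)" "finite_measure (distr N borel laplace_coords)"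
      using prob_space.prob_space_distr[OF M(1) coordsM] prob_space.prob_space_distr[OF N(1) coordsN]
      by (simp_all add: prob_space.finite_measure)
    fix g :: "real ^ 'n ^ 'n \<Rightarrow> real"
    assume g: "continuous_on UNIV g" "\<And>x. 0 \<le> g x \<and> g x \<le> 1"
    have g_meas: "g \<in> borel_measurable borel" by (rule borel_measurable_continuous_onI[OF g(1)])
    have "\<bar>(\<integral>u. g (laplace_coords u) \<partial>M) - (\<integral>u. g (laplace_coords u) \<partial>N)\<bar> \<le> e" if e: "e > 0" for e
    proof -
      obtain q where q: "real_polynomial_function q" "\<And>y. y \<in> ?K \<Longrightarrow> \<bar>g y - q y\<bar> < e / 2"
        using Stone_Weierstrass_real_polynomial_function[of ?K g "e / 2"] e g(1)
        by (auto intro: continuous_on_subset)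
      note q' = exp_sum[OF exp_sum_polynomial[OF q(1)]]
      have "\<bar>(\<integral>u. g (laplace_coords u) \<partial>M) - (\<integral>u. q (laplace_coords u) \<partial>M)\<bar> \<le> e / 2"
        using close[OF M g _ q(2)] q' by blast
      moreover have "\<bar>(\<integral>u. g (laplace_coords u) \<partial>N) - (\<integral>u. q (laplace_coords u) \<partial>N)\<bar> \<le> e / 2"
        using close[OF N g _ q(2)] q' by blast
      ultimately show ?thesis using q' by linarith
    qed
    then have "(\<integral>u. g (laplace_coords u) \<partial>M) = (\<integral>u. g (laplace_coords u) \<partial>N)"
      by (metis abs_le_zero_iff eq_iff_diff_eq_0 field_le_epsilon add_0)
    then show "(\<integral>x. g x \<partial>distr M borel laplace_coords) = (\<integral>x. g x \<partial>distr N borel laplace_coords)"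
      by (simp add: integral_distr[OF coordsM g_meas] integral_distr[OF coordsN g_meas])
  qed simp_all
  moreover have inv_meas: "laplace_coords_inv \<in> borel_measurable (borel :: (real ^ 'n ^ 'n) measure)"
    unfolding laplace_coords_inv_def[abs_def] Let_def by measurable
  ultimately have "distr M borel (laplace_coords_inv \<circ> laplace_coords) = distr N borel (laplace_coords_inv \<circ> laplace_coords)"
    using distr_distr[OF inv_meas coordsM] distr_distr[OF inv_meas coordsN] by simp
  \<comment> \<open>The composition is the identity only on symmetric matrices, which suffices
    because the space of \<open>L\<close> is the cone.\<close>
  moreover have "distr L borel (laplace_coords_inv \<circ> laplace_coords) = distr L borel (\<lambda>u. u)"
    if "sets L = sets posdef_borel" for L :: "(real ^ 'n ^ 'n) measure"
    by (rule distr_cong) (auto simp: space[OF that] laplace_coords_inv posdef_coneD(1))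
  ultimately have id: "distr M borel (\<lambda>u. u) = distr N borel (\<lambda>u. u)" using M(2) N(2) by simp
  show ?thesis
  proof (rule measure_eqI)
    show "sets M = sets N" using M N by simp
    fix A assume A: "A \<in> sets M"
    then obtain B where B: "B \<in> sets borel" "A = B \<inter> posdef_cone"
      using M(2) by (auto simp: sets_restrict_space)
    have "emeasure (distr M borel (\<lambda>u. u)) B = emeasure M A"
      using B posdef_cone_measurable[OF M(2), of "\<lambda>u. u"] by (subst emeasure_distr) (auto simp: space[OF M(2)])
    moreover have "emeasure (distr N borel (\<lambda>u. u)) B = emeasure N A"
      using B posdef_cone_measurable[OF N(2), of "\<lambda>u. u"] by (subst emeasure_distr) (auto simp: space[OF N(2)])
    ultimately show "emeasure M A = emeasure N A" using id by simp
  qed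
qed

section \<open>The Wishart law and the mixture\<close>

text \<open>The value at singular matrices is irrelevant, since \<open>row_weight a\<close> vanishes there
  even for \<open>a \<le> 0\<close>: \<open>0 powr a = 0\<close>.\<close>

definition gram_of_rows :: "('n::finite \<Rightarrow> real ^ 'n) \<Rightarrow> real ^ 'n ^ 'n" where
  "gram_of_rows f = (if det (\<chi> i. f i) = 0 then mat 1 else transpose (\<chi> i. f i) ** (\<chi> i. f i))"

lemma measurable_gram_of_rows [measurable]: "gram_of_rows \<in> lborel_rows \<rightarrow>\<^sub>M posdef_borel"
proof (rule measurable_restrict_space2)
  show "gram_of_rows \<in> space lborel_rows \<rightarrow> posdef_cone"
    by (auto simp: gram_of_rows_def posdef_cone_id posdef_cone_gram)
  show "gram_of_rows \<in> borel_measurable lborel_rows"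
    unfolding gram_of_rows_def[abs_def] transpose_def by measurable
qed

text \<open>The exponential factor only shifts the matrix parameter, so the Laplace transform
  becomes a quotient of two row integrals.\<close>

lemma row_weight_laplace:
  "row_weight a t f * exp (- trace (s ** gram_of_rows f)) = row_weight a (s + t) f"
proof (cases "det (\<chi> i. f i) = 0")
  case True
  then show ?thesis by (simp add: row_weight_def)
next
  case False
  then show ?thesis
    by (simp add: gram_of_rows_def trace_mult_gram row_weight_def matrix_vector_mult_add_rdistrib
        inner_add_right sum.distrib exp_add exp_minus exp_diff field_simps)
qed

text \<open>The Gaussian factor shifts the matrix by \<open>x x^T / 2\<close>, whence the scaling by
  \<open>1 / sqrt 2\<close>. The root of the determinant is \<open>|det R|\<close> and raises the
  exponent by one.\<close>

lemma row_weight_gauss: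
  "row_weight a t f * (exp (- (x \<bullet> (gram_of_rows f *v x)) / 2) * sqrt (det (gram_of_rows f)))
    = row_weight (a + 1) (t + outer ((1 / sqrt 2) *\<^sub>R x)) f"
proof (cases "det (\<chi> i. f i) = 0")
  case True
  then show ?thesis by (simp add: row_weight_def)
next
  case False
  let ?y = "(1 / sqrt 2) *\<^sub>R x"
  have "x \<bullet> (gram_of_rows f *v x) / 2 = ?y \<bullet> (gram_of_rows f *v ?y)"
    by (simp add: matrix_vector_mult_scaleR field_simps)
  also have "\<dots> = (\<Sum>i\<in>UNIV. f i \<bullet> (outer ?y *v f i))"
    using False inner_gram_mult_vector[of ?y "\<chi> i. f i"] by (simp add: gram_of_rows_def)
  finally have quad: "- (x \<bullet> (gram_of_rows f *v x)) / 2 = - (\<Sum>i\<in>UNIV. f i \<bullet> (outer ?y *v f i))"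
    by simp
  have sq: "sqrt (det (gram_of_rows f)) = \<bar>det (\<chi> i. f i)\<bar>"
    using False by (simp add: gram_of_rows_def det_mul)
  show ?thesis
    unfolding quad sq using False
    by (simp add: row_weight_def matrix_vector_mult_add_rdistrib
        inner_add_right sum.distrib exp_add exp_minus exp_diff powr_add field_simps)
qed

text \<open>The mixture integral is evaluated together with the construction because for this
  particular \<open>M\<close> it is again a row integral. Uniqueness later identifies
  \<open>M\<close> with \<open>wishart p \<sigma>\<close>.\<close>

lemma wishart_exists:
  fixes \<sigma> :: "real ^ 'n ^ 'n"
  assumes p: "p > (real CARD('n) - 1) / 2" and sigma: "\<sigma> \<in> posdef_cone"
  obtains M where "is_wishart p \<sigma> M"
    "\<And>x. (\<integral>\<^sup>+u. ennreal (exp (- (x \<bullet> (u *v x)) / 2) * sqrt (det u)) \<partial>M)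
      = ennreal (Gamma (p + 1 / 2) / Gamma (p - (real CARD('n) - 1) / 2)
        * (sqrt (det \<sigma>) / (1 + 1 / 2 * (x \<bullet> (\<sigma> *v x))) powr (p + 1 / 2)))"
proof -
  \<comment> \<open>Chosen so that \<open>(a + n) / 2 = p\<close>; the condition
    \<open>a > - 1\<close> is then the condition on \<open>p\<close>.\<close>
  define a where "a = 2 * p - real CARD('n)"
  have a: "a > - 1" using p by (simp add: a_def field_simps)
  have half: "(a + real CARD('n)) / 2 = p" "(a + 1 + real CARD('n)) / 2 = p + 1 / 2"
    "(a + 1) / 2 = p - (real CARD('n) - 1) / 2"
    "- (a + real CARD('n)) / 2 = - p" "- (a + 1 + real CARD('n)) / 2 = - (p + 1 / 2)"
    by (simp_all add: a_def field_simps)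
  define \<tau> where "\<tau> = matrix_inv \<sigma>"
  have \<tau>: "\<tau> \<in> posdef_cone" "det \<tau> = 1 / det \<sigma>" "matrix_inv \<tau> = \<sigma>" "\<sigma> ** \<tau> = mat 1"
    using matrix_inv_posdef_cone[OF sigma] by (simp_all add: \<tau>_def)
  have det\<sigma>: "det \<sigma> > 0" and det\<tau>: "det \<tau> > 0" using sigma \<tau>(1) by (simp_all add: posdef_cone_det_pos)
  define c where "c b = enn2real (row_integral b (mat 1 :: real ^ 'n ^ 'n))" for b
  have c: "row_integral b (mat 1 :: real ^ 'n ^ 'n) = ennreal (c b)" "c b > 0" if "b > - 1" for b
    using row_integral_id_finite[OF that, where 'n = 'n] row_integral_id_pos[of b, where 'n = 'n]
    by (simp_all add: c_def enn2real_positive_iff)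
  have Gpos: "Gamma (p - (real CARD('n) - 1) / 2) > 0" "Gamma (p + 1 / 2) > 0"
    using p by (auto intro!: Gamma_real_pos simp: field_simps)
  \<comment> \<open>The recursion expresses \<open>c a\<close> through \<open>c (a + 1)\<close>; its
    inverse carries the Gamma quotient of the final formula.\<close>
  have ratio: "c (a + 1) = Gamma (p + 1 / 2) / Gamma (p - (real CARD('n) - 1) / 2) * c a"
  proof -
    have "ennreal (c a) = ennreal (Gamma (p - (real CARD('n) - 1) / 2) / Gamma (p + 1 / 2)) * ennreal (c (a + 1))"
      using row_integral_id_step[OF a, where 'n = 'n] a by (simp only: c half)
    then have "c a = Gamma (p - (real CARD('n) - 1) / 2) / Gamma (p + 1 / 2) * c (a + 1)"
      using Gpos c(2)[of a] c(2)[of "a + 1"] a by (simp add: ennreal_mult[symmetric])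
    then show ?thesis using Gpos by (simp add: field_simps)
  qed
  have row_a: "row_integral a s = ennreal (det s powr (- p) * c a)" if "s \<in> posdef_cone" for s :: "real ^ 'n ^ 'n"
    using row_integral_eq[OF that, of a] a
    by (simp only: half c(1) ennreal_mult[OF powr_ge_zero less_imp_le[OF c(2)]])
  have row_a1: "row_integral (a + 1) s = ennreal (det s powr (- (p + 1 / 2)) * c (a + 1))"
    if "s \<in> posdef_cone" for s :: "real ^ 'n ^ 'n"
  proof -
    have "a + 1 > - 1" using a by simp
    then show ?thesis
      using row_integral_eq[OF that, of "a + 1"]
      by (simp only: half c(1) ennreal_mult[OF powr_ge_zero less_imp_le[OF c(2)]])
  qed
  \<comment> \<open>By \<open>row_a\<close> this is the value of
    \<open>row_integral a \<tau>\<close>, the normalising constant.\<close>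
  define Z where "Z = det \<tau> powr (- p) * c a"
  have Z: "Z > 0" using det\<tau> c(2)[OF a] by (simp add: Z_def)
  define M where "M = distr (density lborel_rows (\<lambda>f. ennreal (row_weight a \<tau> f / Z))) posdef_borel gram_of_rows"
  have sets_M: "sets M = sets posdef_borel" by (simp add: M_def)
  have nn_M: "(\<integral>\<^sup>+u. ennreal (g u) \<partial>M) = ennreal (1 / Z) * (\<integral>\<^sup>+f. ennreal (row_weight a \<tau> f * g (gram_of_rows f)) \<partial>lborel_rows)"
    if g: "g \<in> borel_measurable borel" "\<And>u. g u \<ge> 0" for g :: "real ^ 'n ^ 'n \<Rightarrow> real"
  proof -
    have [measurable]: "g \<in> borel_measurable posdef_borel" using g(1) by (rule measurable_restrict_space1)
    have "(\<integral>\<^sup>+u. ennreal (g u) \<partial>M)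
      = (\<integral>\<^sup>+f. ennreal (row_weight a \<tau> f / Z) * ennreal (g (gram_of_rows f)) \<partial>lborel_rows)"
      unfolding M_def by (simp add: nn_integral_distr nn_integral_density)
    also have "\<dots> = (\<integral>\<^sup>+f. ennreal (1 / Z) * ennreal (row_weight a \<tau> f * g (gram_of_rows f)) \<partial>lborel_rows)"
      using Z g(2) by (intro nn_integral_cong) (simp add: ennreal_mult[symmetric] row_weight_nonneg)
    finally show ?thesis by (simp add: nn_integral_cmult)
  qed
  \<comment> \<open>Assuming only that \<open>s + \<tau>\<close> lies in the cone admits
    \<open>s = 0\<close>, which yields the total mass 1.\<close>
  have laplace: "(\<integral>\<^sup>+u. ennreal (exp (- trace (s ** u))) \<partial>M) = ennreal (1 / det (mat 1 + \<sigma> ** s) powr p)"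
    if s: "s + \<tau> \<in> posdef_cone" for s
  proof -
    have "det \<sigma> * det (s + \<tau>) = det (mat 1 + \<sigma> ** s)"
      using \<tau>(4) by (simp add: det_mul[symmetric] matrix_add_ldistrib add.commute)
    then have det: "det (s + \<tau>) = det (mat 1 + \<sigma> ** s) / det \<sigma>" using det\<sigma> by (simp add: field_simps)
    then have pos: "det (mat 1 + \<sigma> ** s) > 0"
      using posdef_cone_det_pos[OF s] det\<sigma> by (simp add: zero_less_divide_iff)
    have "(\<integral>\<^sup>+u. ennreal (exp (- trace (s ** u))) \<partial>M) = ennreal (1 / Z) * row_integral a (s + \<tau>)"
      by (subst nn_M) (auto simp: row_weight_laplace row_integral_def measurable_exp_neg_trace)
    also have "\<dots> = ennreal (det (s + \<tau>) powr (- p) / det \<tau> powr (- p))"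
    proof -
      have "ennreal (1 / Z) * row_integral a (s + \<tau>) = ennreal (1 / Z * (det (s + \<tau>) powr (- p) * c a))"
        using Z c(2)[OF a] by (subst row_a[OF s], subst ennreal_mult[symmetric]) auto
      then show ?thesis using c(2)[OF a] by (simp add: Z_def)
    qed
    also have "det (s + \<tau>) powr (- p) / det \<tau> powr (- p) = 1 / det (mat 1 + \<sigma> ** s) powr p"
      unfolding det \<tau>(2) using det\<sigma> pos by (simp add: powr_divide powr_minus field_simps)
    finally show ?thesis .
  qed
  have M_prob: "prob_space M"
  proof
    show "emeasure M (space M) = 1"
      using laplace[of 0] \<tau>(1) by (simp add: trace_zero)
  qed
  have "is_wishart p \<sigma> M"
    unfolding is_wishart_def
  proof (intro conjI ballI M_prob sets_M)
    fix s :: "real ^ 'n ^ 'n" assume "s \<in> posdef_cone"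
    then have s: "s + \<tau> \<in> posdef_cone" using \<tau>(1) by (rule posdef_cone_add)
    show "(\<integral>u. exp (- trace (s ** u)) \<partial>M) = 1 / det (mat 1 + \<sigma> ** s) powr p"
      by (subst integral_eq_nn_integral)
         (auto simp: laplace[OF s] intro!: posdef_cone_measurable[OF sets_M] measurable_exp_neg_trace)
  qed
  moreover have "(\<integral>\<^sup>+u. ennreal (exp (- (x \<bullet> (u *v x)) / 2) * sqrt (det u)) \<partial>M)
      = ennreal (Gamma (p + 1 / 2) / Gamma (p - (real CARD('n) - 1) / 2)
        * (sqrt (det \<sigma>) / (1 + 1 / 2 * (x \<bullet> (\<sigma> *v x))) powr (p + 1 / 2)))" for x
  proof -
    define y where "y = (1 / sqrt 2) *\<^sub>R x"
    define r where "r = 1 + 1 / 2 * (x \<bullet> (\<sigma> *v x))"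
    have r: "r > 0" using posdef_coneD(3)[OF sigma, of x] by (simp add: r_def)
    have "y \<bullet> (\<sigma> *v y) = 1 / 2 * (x \<bullet> (\<sigma> *v x))"
      by (simp add: y_def matrix_vector_mult_scaleR field_simps)
    then have det: "det (\<tau> + outer y) = det \<tau> * r"
      using det_posdef_cone_add_outer[OF \<tau>(1), of y] by (simp add: \<tau>(3) r_def)
    \<comment> \<open>The absolute value makes \<open>g\<close> nonnegative on all matrices, as
      \<open>nn_M\<close> requires; on the cone it changes nothing.\<close>
    define g where "g u = exp (- (x \<bullet> (u *v x)) / 2) * sqrt \<bar>det u\<bar>" for u :: "real ^ 'n ^ 'n"
    have "(\<integral>\<^sup>+u. ennreal (exp (- (x \<bullet> (u *v x)) / 2) * sqrt (det u)) \<partial>M) = (\<integral>\<^sup>+u. ennreal (g u) \<partial>M)"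
      using sets_eq_imp_space_eq[OF sets_M]
      by (intro nn_integral_cong) (simp add: g_def space_restrict_space abs_of_pos posdef_cone_det_pos)
    also have "\<dots> = ennreal (1 / Z) * (\<integral>\<^sup>+f. ennreal (row_weight a \<tau> f * g (gram_of_rows f)) \<partial>lborel_rows)"
      by (rule nn_M) (unfold g_def, measurable)
    also have "(\<integral>\<^sup>+f. ennreal (row_weight a \<tau> f * g (gram_of_rows f)) \<partial>lborel_rows) = row_integral (a + 1) (\<tau> + outer y)"
    proof -
      have "\<bar>det (gram_of_rows f)\<bar> = det (gram_of_rows f)" for f :: "'n \<Rightarrow> real ^ 'n"
        by (simp add: gram_of_rows_def det_mul)
      then show ?thesis by (simp only: g_def row_weight_gauss y_def row_integral_def)
    qed
    also have "ennreal (1 / Z) * row_integral (a + 1) (\<tau> + outer y)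
      = ennreal (1 / Z * ((det \<tau> * r) powr (- (p + 1 / 2)) * c (a + 1)))"
      using Z by (simp only: row_a1[OF posdef_cone_add_outer[OF \<tau>(1)]] det ennreal_mult'[symmetric]
          less_imp_le zero_le_divide_1_iff)
    also have "1 / Z * ((det \<tau> * r) powr (- (p + 1 / 2)) * c (a + 1))
      = Gamma (p + 1 / 2) / Gamma (p - (real CARD('n) - 1) / 2) * (sqrt (det \<sigma>) / r powr (p + 1 / 2))"
    proof -
      \<comment> \<open>Splitting off \<open>det \<tau> powr (- p)\<close> cancels that factor of
        \<open>Z\<close>; the remaining power \<open>- 1 / 2\<close> of \<open>det \<tau>\<close> is
        \<open>sqrt (det \<sigma>)\<close>.\<close>
      have "(det \<tau> * r) powr (- (p + 1 / 2)) = det \<tau> powr (- p) * (det \<tau> powr (- (1 / 2)) / r powr (p + 1 / 2))"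
      proof -
        have "(det \<tau> * r) powr (- (p + 1 / 2)) = det \<tau> powr (- p + - (1 / 2)) * r powr (- (p + 1 / 2))"
          using det\<tau> r by (simp add: powr_mult)
        also have "\<dots> = det \<tau> powr (- p) * det \<tau> powr (- (1 / 2)) * r powr (- (p + 1 / 2))"
          by (simp only: powr_add)
        finally show ?thesis by (simp only: powr_minus_divide[of r]) simp
      qed
      moreover have "det \<tau> powr (- (1 / 2)) = sqrt (det \<sigma>)"
        using det\<sigma> by (simp add: \<tau>(2) powr_minus powr_divide powr_half_sqrt real_sqrt_divide)
      ultimately show ?thesis
        using det\<tau> c(2)[OF a] by (simp add: Z_def ratio mult.commute)
    qed
    finally show ?thesis unfolding r_def .
  qed
  ultimately show thesis using that by blast
qed

lemma is_wishart_unique: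
  assumes "is_wishart p \<sigma> M" "is_wishart p \<sigma> N"
  shows "M = N"
  using assms by (intro laplace_transform_inj) (auto simp: is_wishart_def)

text \<open>With covariance the inverse of \<open>u\<close>, the inverse in the normal density
  cancels. Finiteness is proved first because \<open>measure\<close> is 0 on sets of infinite
  measure, so only then does it agree with the integral.\<close>

lemma emeasure_mv_normal_matrix_inv:
  fixes u :: "real ^ 'n ^ 'n"
  assumes u: "u \<in> posdef_cone" and A: "A \<in> sets borel"
  shows "ennreal (measure (mv_normal 0 (matrix_inv u)) A) =
    (\<integral>\<^sup>+x. ennreal (1 / (2 * pi) powr (real CARD('n) / 2) * (exp (- (x \<bullet> (u *v x)) / 2) * sqrt (det u))) * indicator A x \<partial>lborel)"
    (is "_ = ?r A")
proof -
  note inv = matrix_inv_posdef_cone[OF u]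
  have detu: "det u > 0" by (rule posdef_cone_det_pos[OF u])
  let ?k = "1 / (2 * pi) powr (real CARD('n) / 2) * sqrt (det u)"
  have dens: "mv_normal 0 (matrix_inv u) = density lborel (\<lambda>x. ennreal
      (1 / (2 * pi) powr (real CARD('n) / 2) * (exp (- (x \<bullet> (u *v x)) / 2) * sqrt (det u))))"
    unfolding mv_normal_def inv(4,5) by (simp add: real_sqrt_divide)
  have em: "emeasure (mv_normal 0 (matrix_inv u)) B = ?r B" if "B \<in> sets borel" for B
    unfolding dens using that by (subst emeasure_density) auto
  have "?r UNIV < \<infinity>"
  proof -
    \<comment> \<open>Half of \<open>u\<close> absorbs the factor \<open>1 / 2\<close> in the
      exponent, so that \<open>nn_integral_exp_neg_quadratic\<close> applies.\<close>
    have half: "(1 / 2) *\<^sub>R u \<in> posdef_cone"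
    proof -
      have "transpose ((1 / 2) *\<^sub>R u) = (1 / 2) *\<^sub>R u"
        using posdef_coneD(1)[OF u] by (simp add: transpose_scalar)
      then show ?thesis
        using posdef_coneD(2)[OF u] by (simp add: posdef_cone_def scaleR_matrix_vector_assoc[symmetric])
    qed
    have "?r UNIV = (\<integral>\<^sup>+x. ennreal ?k * ennreal (exp (- (x \<bullet> (((1 / 2) *\<^sub>R u) *v x)))) \<partial>lborel)"
      using detu by (intro nn_integral_cong)
        (simp add: scaleR_matrix_vector_assoc[symmetric] ennreal_mult[symmetric] mult_ac)
    also have "\<dots> < \<infinity>"
      by (simp add: nn_integral_cmult nn_integral_exp_neg_quadratic[OF half] ennreal_mult_less_top)
    finally show ?thesis .
  qed
  then have "emeasure (mv_normal 0 (matrix_inv u)) (space (mv_normal 0 (matrix_inv u))) \<noteq> \<infinity>"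
    using em[of UNIV] by (simp add: dens)
  then have "finite_measure (mv_normal 0 (matrix_inv u))" by (rule finite_measureI)
  from finite_measure.emeasure_eq_measure[OF this] show ?thesis using em[OF A] by simp
qed

text \<open>Averaging the conditional normal density over the law of \<open>U\<close> and exchanging
  the two integrals identifies the average as the density of \<open>X\<close>. The closed form is
  the mixture integral from \<open>wishart_exists\<close>.\<close>

theorem proposition2p1:
  fixes p :: real and \<sigma> :: "real ^ 'n ^ 'n"
    and P :: "'a measure" and U :: "'a \<Rightarrow> real ^ 'n ^ 'n" and X :: "'a \<Rightarrow> real ^ 'n"
  assumes p: "p > (real CARD('n) - 1) / 2"
    and sigma: "\<sigma> \<in> posdef_cone"
    and P: "prob_space P"
    and U: "U \<in> measurable P posdef_borel"
    and U_wishart: "distr P posdef_borel U = wishart p \<sigma>"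
    and X: "X \<in> measurable P borel"
    and X_cond: "has_cond_law P borel X posdef_borel U (\<lambda>u. mv_normal 0 (matrix_inv u))"
  shows "distributed P lborel X (\<lambda>x. ennreal (mixture_density p \<sigma> x)) \<and>
    (\<forall>x. mixture_density p \<sigma> x =
       1 / (2 * pi) powr (real CARD('n) / 2)
       * (Gamma (p + 1 / 2) / Gamma (p - (real CARD('n) - 1) / 2))
       * (sqrt (det \<sigma>) / (1 + 1 / 2 * (x \<bullet> (\<sigma> *v x))) powr (p + 1 / 2)))"
proof -
  interpret prob_space P by fact
  let ?k = "1 / (2 * pi) powr (real CARD('n) / 2)"
  let ?G = "Gamma (p + 1 / 2) / Gamma (p - (real CARD('n) - 1) / 2)"
  let ?S = "\<lambda>x. sqrt (det \<sigma>) / (1 + 1 / 2 * (x \<bullet> (\<sigma> *v x))) powr (p + 1 / 2)"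
  let ?g = "\<lambda>(u :: real ^ 'n ^ 'n) x. exp (- (x \<bullet> (u *v x)) / 2) * sqrt (det u)"
  obtain M where M: "is_wishart p \<sigma> M" "\<And>x. (\<integral>\<^sup>+u. ennreal (?g u x) \<partial>M) = ennreal (?G * ?S x)"
    using wishart_exists[OF p sigma] by blast
  \<comment> \<open>Existence by construction and uniqueness by the Laplace transform make the
    definite description denote \<open>M\<close>.\<close>
  have M_eq: "wishart p \<sigma> = M"
    unfolding wishart_def using M(1) is_wishart_unique by (intro the_equality)
  have sets_M: "sets M = sets posdef_borel" using M(1) by (simp add: is_wishart_def)
  have space_M: "space M = posdef_cone"
    using sets_eq_imp_space_eq[OF sets_M] by (simp add: space_restrict_space)
  have GS: "0 \<le> ?G * ?S x" for x
  proof -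
    have "?G \<ge> 0" using p by (auto intro!: divide_nonneg_nonneg less_imp_le[OF Gamma_real_pos] simp: field_simps)
    moreover have "?S x \<ge> 0" using posdef_cone_det_pos[OF sigma] by simp
    ultimately show ?thesis by (rule mult_nonneg_nonneg)
  qed
  have density: "mixture_density p \<sigma> x = ?k * ?G * ?S x" for x
  proof -
    \<comment> \<open>\<open>mixture_density\<close> is a Bochner integral; its integrand is
      nonnegative on the cone, so it equals the real value of the nonnegative integral known for
      \<open>M\<close>.\<close>
    have "(\<lambda>u. ?g u x) \<in> borel_measurable M" by (rule posdef_cone_measurable[OF sets_M]) measurable
    then have "(\<integral>u. ?g u x \<partial>M) = enn2real (\<integral>\<^sup>+u. ennreal (?g u x) \<partial>M)"
      by (rule integral_eq_nn_integral)
         (auto simp: space_M posdef_cone_det_pos less_imp_le intro!: AE_I2)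
    then show ?thesis using GS[of x] by (simp only: mixture_density_def M_eq M(2) enn2real_ennreal mult.assoc)
  qed
  have meas[measurable]: "(\<lambda>x. ennreal (mixture_density p \<sigma> x)) \<in> borel_measurable borel"
    unfolding density by measurable
  have U_borel[measurable]: "U \<in> borel_measurable P"
    using measurable_restrict_space2_iff[of U P borel posdef_cone] U by blast
  have U_cone: "U \<omega> \<in> posdef_cone" if "\<omega> \<in> space P" for \<omega>
    using measurable_space[OF U that] by (simp add: space_restrict_space)
  interpret pair_sigma_finite P "lborel :: (real ^ 'n) measure" ..
  have "distr P lborel X = density lborel (\<lambda>x. ennreal (mixture_density p \<sigma> x))"
  proof (rule measure_eqI)
    fix A assume "A \<in> sets (distr P lborel X)"
    then have A[measurable]: "A \<in> sets borel" by simp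
    let ?F = "vimage_algebra (space P) U posdef_borel"
    let ?XA = "X -` A \<inter> space P"
    have XA: "?XA \<in> sets P" using X A by (rule measurable_sets)
    have "subalgebra P ?F"
      using U by (simp add: subalgebra_def measurable_iff_sets)
    then interpret F: finite_measure_subalgebra P ?F
      by unfold_locales
    have ind: "integrable P (indicator ?XA :: 'a \<Rightarrow> real)"
      using XA by (rule integrable_real_indicator) (simp add: less_top[symmetric])
    have cond: "AE \<omega> in P. real_cond_exp P ?F (indicator ?XA) \<omega> = measure (mv_normal 0 (matrix_inv (U \<omega>))) A"
      using X_cond A by (simp add: has_cond_law_def)
    have "emeasure (distr P lborel X) A = emeasure P ?XA"
      using X by (subst emeasure_distr) auto
    also have "\<dots> = ennreal (\<integral>\<omega>. indicator ?XA \<omega> \<partial>P)" using XA by (simp add: emeasure_eq_measure)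
    \<comment> \<open>Total probability: conditional expectation preserves the integral of the
      indicator.\<close>
    also have "\<dots> = ennreal (\<integral>\<omega>. real_cond_exp P ?F (indicator ?XA) \<omega> \<partial>P)"
      by (simp add: F.real_cond_exp_int(2)[OF ind])
    \<comment> \<open>Almost sure nonnegativity of the conditional expectation is read off from
      \<open>cond\<close>, whose right side is a measure.\<close>
    also have "\<dots> = (\<integral>\<^sup>+\<omega>. ennreal (real_cond_exp P ?F (indicator ?XA) \<omega>) \<partial>P)"
      using cond by (intro nn_integral_eq_integral[symmetric] F.real_cond_exp_int(1)[OF ind]) auto
    also have "\<dots> = (\<integral>\<^sup>+\<omega>. ennreal (measure (mv_normal 0 (matrix_inv (U \<omega>))) A) \<partial>P)"
      using cond by (intro nn_integral_cong_AE) auto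
    also have "\<dots> = (\<integral>\<^sup>+\<omega>. \<integral>\<^sup>+x. ennreal (?k * ?g (U \<omega>) x) * indicator A x \<partial>lborel \<partial>P)"
      by (intro nn_integral_cong emeasure_mv_normal_matrix_inv U_cone A)
    also have "\<dots> = (\<integral>\<^sup>+x. \<integral>\<^sup>+\<omega>. ennreal (?k * ?g (U \<omega>) x) * indicator A x \<partial>P \<partial>lborel)"
      by (rule Fubini'[symmetric]) measurable
    also have "\<dots> = (\<integral>\<^sup>+x. ennreal (mixture_density p \<sigma> x) * indicator A x \<partial>lborel)"
    proof (rule nn_integral_cong)
      fix x :: "real ^ 'n"
      have g_meas: "(\<lambda>u. ?g u x) \<in> borel_measurable posdef_borel"
        by (rule measurable_restrict_space1) measurable
      have "(\<integral>\<^sup>+\<omega>. ennreal (?k * ?g (U \<omega>) x) * indicator A x \<partial>P)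
        = (\<integral>\<^sup>+\<omega>. ennreal ?k * ennreal (?g (U \<omega>) x) * indicator A x \<partial>P)"
        by (subst ennreal_mult') auto
      also have "\<dots> = ennreal ?k * (\<integral>\<^sup>+\<omega>. ennreal (?g (U \<omega>) x) \<partial>P) * indicator A x"
        by (simp add: nn_integral_cmult nn_integral_multc)
      also have "(\<integral>\<^sup>+\<omega>. ennreal (?g (U \<omega>) x) \<partial>P) = (\<integral>\<^sup>+u. ennreal (?g u x) \<partial>distr P posdef_borel U)"
        using g_meas by (subst nn_integral_distr[OF U]) auto
      also have "\<dots> = ennreal (?G * ?S x)" by (simp only: U_wishart M_eq M(2))
      also have "ennreal ?k * \<dots> = ennreal (mixture_density p \<sigma> x)"
        unfolding density using GS[of x] by (subst ennreal_mult[symmetric]) (auto simp: mult.assoc)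
      finally show "(\<integral>\<^sup>+\<omega>. ennreal (?k * ?g (U \<omega>) x) * indicator A x \<partial>P)
        = ennreal (mixture_density p \<sigma> x) * indicator A x" .
    qed
    also have "\<dots> = emeasure (density lborel (\<lambda>x. ennreal (mixture_density p \<sigma> x))) A"
      by (subst emeasure_density) auto
    finally show "emeasure (distr P lborel X) A
      = emeasure (density lborel (\<lambda>x. ennreal (mixture_density p \<sigma> x))) A" .
  qed simp
  then show ?thesis using X meas density by (simp add: distributed_def)
qed

end
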